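(* Consider the affinity-scheduling system with $N$ servers, service rates $\mu_1>\mu_2>0$, and Poisson arrival rates $\lambda_S\ge 0$ for server selections $S\subseteq\{1,\dots,N\}$; let $\mathcal{S}$ be the collection of (nonempty) selections $S$ with $\lambda_S>0$. Define $$\lambda_0 = \min_{(p_{Sn})}\ \max_{1\le n\le N}\ \sum_{S\in\mathcal{S}:\, n\in S}\lambda_S\, p_{Sn},$$ where the minimum is over all families $(p_{Sn})_{S\in\mathcal{S},\,n\in S}$ with $p_{Sn}\ge 0$ and $\sum_{n\in S}p_{Sn}=1$ for every $S\in\mathcal{S}$. Consider also the reference system with $N$ servers operating under the random assignment (RA) policy with arrival rate $\lambda_0$ per server (total arrival rate $\lambda_0 N$) and service rate $\mu_1$ at each server. If the initial configurations satisfy $\overline{Q}^{\mathrm{aff}}_{m+}(0)\le \overline{Q}^{\mathrm{RA}}_{m+}(0)$ for all $m\ge 1$, then $$\{(\overline{Q}_{m+}^{\mathrm{aff}}(t))_{m \geq 1}\}_{t \geq 0} \ \leq_{\mathrm{st}}\ \{(\overline{Q}_{m+}^{\mathrm{RA}}(t))_{m \geq 1}\}_{t \geq 0}.$$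
   Context: **Affinity-scheduling system.** There are $N$ servers. For each selection $S\subseteq\{1,\dots,N\}$ jobs arrive according to a Poisson process of rate $\lambda_S\ge 0$, independently over $S$. The servers in $S$ are primary and those in $S^c$ secondary for such jobs. A job allocated to a primary server becomes a type I job there (exponential service requirement with rate $\mu_1$); a job allocated to a secondary server becomes a type II job there (exponential service requirement with rate $\mu_2<\mu_1$); all service times are independent. Allocation of a job arriving with selection $S$: 1. If some server in $S$ is completely idle (no jobs), allocate the job as type I to one of these idle servers. 2. Otherwise, if some server in $S^c$ is completely idle, allocate the job as type II to one of these idle servers. 3. Otherwise, allocate the job as type I to the server in $S$ with the smallest number of type I jobs, ties being broken in favor of fewer type II jobs. Any remaining ties are broken by an arbitrary (possibly randomized) rule depending only on the current state and $S$. Each server uses preemptive priority in favor of type I jobs, type I jobs being served in order of arrival: a server with at least one type I job completes type I jobs at rate $\mu_1$; a server with no type I jobs but at least one type II job completes type II jobs at rate $\mu_2$. The vector of numbers of type I and type II jobs at all servers is a continuous-time Markov process. Initially there are finitely many jobs; initial configurations are deterministic. **RA reference system.** There are $N$ servers with a single type of job; each arriving job is assigned to a server chosen uniformly at random; each server serves its queue first-come first-served with independent exponential service times of rate $\mu_1$. **Notation.** $\overline{Q}^{\mathrm{aff}}_i(t)$ is the number of servers with at least $i$ type I jobs at time $t$ in the affinity-scheduling system, and $\overline{Q}^{\mathrm{RA}}_i(t)$ is the number of servers with at least $i$ jobs (including any in service) at time $t$ in the RA system. Put $\overline{Q}_{m+}^{\mathrm{aff}}(t)=\sum_{i\ge m}\overline{Q}^{\mathrm{aff}}_i(t)$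 and $\overline{Q}_{m+}^{\mathrm{RA}}(t)=\sum_{i\ge m}\overline{Q}^{\mathrm{RA}}_i(t)$. **Stochastic order.** $\{(X_m(t))_{m\ge1}\}_{t\ge0}\le_{\mathrm{st}}\{(Y_m(t))_{m\ge1}\}_{t\ge0}$ means that the two processes can be constructed on a common probability space (with their respective laws) such that almost surely $X_m(t)\le Y_m(t)$ for all $m\ge1$ and $t\ge0$. *)

theory Defs
  imports "HOL-Probability.Probability"
begin

text \<open>
  A time-homogeneous continuous-time Markov chain on a countable state space is described by its
  generator, acting on functions by \<open>(A f) x = (\<Sum>y. q x y * (f y - f x))\<close> for transition rates \<open>q\<close>.
  All generators below have uniformly bounded total rates, so that the transition function is
  the exponential \<open>exp (t A)\<close>, given by an everywhere convergent power series.
\<close>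

definition semigroup_of ::
    "(('s \<Rightarrow> real) \<Rightarrow> 's \<Rightarrow> real) \<Rightarrow> real \<Rightarrow> ('s \<Rightarrow> real) \<Rightarrow> 's \<Rightarrow> real" where
  "semigroup_of A t f x = (\<Sum>k. t ^ k / fact k * (A ^^ k) f x)"

definition right_continuous_paths :: "'w measure \<Rightarrow> (real \<Rightarrow> 'w \<Rightarrow> 's) \<Rightarrow> bool" where
  "right_continuous_paths M X \<longleftrightarrow>
     (AE \<omega> in M. \<forall>t\<ge>0. eventually (\<lambda>s. X s \<omega> = X t \<omega>) (at_right t))"

text \<open>
  Time is \<open>t \<ge> 0\<close>; values at negative times are irrelevant.  The last clause is the Markov
  property relative to the past up to time \<open>s\<close>, observed at finitely many times \<open>J\<close>; it is stated
  multiplicatively, so that conditioning events of probability \<open>0\<close> need no special treatment.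
\<close>

definition markov_jump_process ::
    "(('s::countable \<Rightarrow> real) \<Rightarrow> 's \<Rightarrow> real) \<Rightarrow> 's \<Rightarrow> 'w measure \<Rightarrow> (real \<Rightarrow> 'w \<Rightarrow> 's) \<Rightarrow> bool" where
  "markov_jump_process A x0 M X \<longleftrightarrow>
     prob_space M \<and>
     (\<forall>t\<ge>0. X t \<in> measurable M (count_space UNIV)) \<and>
     right_continuous_paths M X \<and>
     (AE \<omega> in M. X 0 \<omega> = x0) \<and>
     (\<forall>s\<ge>0. \<forall>t\<ge>0. \<forall>J z y. finite J \<and> J \<subseteq> {0..s} \<longrightarrow>
        measure M {\<omega> \<in> space M. (\<forall>u\<in>J. X u \<omega> = z u) \<and> X s \<omega> = z s \<and> X (s + t) \<omega> = y} =
        measure M {\<omega> \<in> space M. (\<forall>u\<in>J. X u \<omega> = z u) \<and> X s \<omega> = z s} *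
          semigroup_of A t (indicator {y}) (z s))"

text \<open>
  The servers are the elements of a finite type \<open>'n\<close>, so \<open>N = CARD('n)\<close>.  The state gives for each
  server the pair (number of type I jobs, number of type II jobs).
\<close>

type_synonym 'n aff_state = "'n \<Rightarrow> nat \<times> nat"

definition selections :: "('n set \<Rightarrow> real) \<Rightarrow> 'n set set" where
  "selections lam = {S. S \<noteq> {} \<and> lam S > 0}"

definition idle :: "'n aff_state \<Rightarrow> 'n \<Rightarrow> bool" where
  "idle x n \<longleftrightarrow> x n = (0, 0)"

text \<open>The servers among which the remaining ties for a job with selection \<open>S\<close> are broken.\<close>

definition candidates :: "'n aff_state \<Rightarrow> 'n set \<Rightarrow> 'n set" where
  "candidates x S =
     (if \<exists>n\<in>S. idle x n then {n \<in> S. idle x n}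
      else if \<exists>n\<in>-S. idle x n then {n \<in> -S. idle x n}
      else {n \<in> S. \<forall>k\<in>S. fst (x n) < fst (x k) \<or>
                          (fst (x n) = fst (x k) \<and> snd (x n) \<le> snd (x k))})"

definition tie_breaking_rule ::
    "('n set \<Rightarrow> real) \<Rightarrow> ('n aff_state \<Rightarrow> 'n set \<Rightarrow> 'n pmf) \<Rightarrow> bool" where
  "tie_breaking_rule lam r \<longleftrightarrow> (\<forall>x. \<forall>S\<in>selections lam. set_pmf (r x S) \<subseteq> candidates x S)"

definition allocate :: "'n set \<Rightarrow> 'n \<Rightarrow> 'n aff_state \<Rightarrow> 'n aff_state" where
  "allocate S n x =
     x(n := if n \<in> S then (Suc (fst (x n)), snd (x n)) else (fst (x n), Suc (snd (x n))))"

definition completion_rate :: "real \<Rightarrow> real \<Rightarrow> 'n aff_state \<Rightarrow> 'n \<Rightarrow> real" where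
  "completion_rate mu1 mu2 x n =
     (if fst (x n) > 0 then mu1 else if snd (x n) > 0 then mu2 else 0)"

definition complete_job :: "'n \<Rightarrow> 'n aff_state \<Rightarrow> 'n aff_state" where
  "complete_job n x =
     x(n := if fst (x n) > 0 then (fst (x n) - 1, snd (x n)) else (fst (x n), snd (x n) - 1))"

definition aff_generator ::
    "('n::finite set \<Rightarrow> real) \<Rightarrow> real \<Rightarrow> real \<Rightarrow> ('n aff_state \<Rightarrow> 'n set \<Rightarrow> 'n pmf) \<Rightarrow>
     ('n aff_state \<Rightarrow> real) \<Rightarrow> 'n aff_state \<Rightarrow> real" where
  "aff_generator lam mu1 mu2 r f x =
     (\<Sum>S\<in>selections lam. \<Sum>n\<in>UNIV. lam S * pmf (r x S) n * (f (allocate S n x) - f x)) +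
     (\<Sum>n\<in>UNIV. completion_rate mu1 mu2 x n * (f (complete_job n x) - f x))"

definition affinity_system ::
    "('n::finite set \<Rightarrow> real) \<Rightarrow> real \<Rightarrow> real \<Rightarrow> ('n aff_state \<Rightarrow> 'n set \<Rightarrow> 'n pmf) \<Rightarrow>
     'n aff_state \<Rightarrow> 'w measure \<Rightarrow> (real \<Rightarrow> 'w \<Rightarrow> 'n aff_state) \<Rightarrow> bool" where
  "affinity_system lam mu1 mu2 r x0 M X \<longleftrightarrow>
     markov_jump_process (aff_generator lam mu1 mu2 r) x0 M X"

text \<open>\<open>a\<close> is the total arrival rate.\<close>

definition ra_generator ::
    "real \<Rightarrow> real \<Rightarrow> (('n::finite \<Rightarrow> nat) \<Rightarrow> real) \<Rightarrow> ('n \<Rightarrow> nat) \<Rightarrow> real" where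
  "ra_generator a mu1 f y =
     (\<Sum>n\<in>UNIV. a * pmf (pmf_of_set UNIV) n * (f (y(n := Suc (y n))) - f y)) +
     (\<Sum>n\<in>UNIV. (if y n > 0 then mu1 else 0) * (f (y(n := y n - 1)) - f y))"

definition ra_system ::
    "real \<Rightarrow> real \<Rightarrow> ('n::finite \<Rightarrow> nat) \<Rightarrow> 'w measure \<Rightarrow> (real \<Rightarrow> 'w \<Rightarrow> 'n \<Rightarrow> nat) \<Rightarrow> bool" where
  "ra_system a mu1 y0 M Y \<longleftrightarrow> markov_jump_process (ra_generator a mu1) y0 M Y"

definition assignment :: "('n set \<Rightarrow> real) \<Rightarrow> ('n set \<Rightarrow> 'n \<Rightarrow> real) \<Rightarrow> bool" where
  "assignment lam p \<longleftrightarrow> (\<forall>S\<in>selections lam. (\<forall>n\<in>S. p S n \<ge> 0) \<and> (\<Sum>n\<in>S. p S n) = 1)"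

definition max_load :: "('n::finite set \<Rightarrow> real) \<Rightarrow> ('n set \<Rightarrow> 'n \<Rightarrow> real) \<Rightarrow> real" where
  "max_load lam p = (MAX n. \<Sum>S | S \<in> selections lam \<and> n \<in> S. lam S * p S n)"

text \<open>
  \<open>LEAST\<close> denotes the minimum of a set of reals; it is attained here since \<open>max_load lam\<close> is
  continuous and the assignments form a compact set in the finitely many relevant coordinates.
\<close>

definition lambda0 :: "('n::finite set \<Rightarrow> real) \<Rightarrow> real" where
  "lambda0 lam = (LEAST l. \<exists>p. assignment lam p \<and> l = max_load lam p)"

text \<open>Applied to the numbers of type I jobs, respectively of all jobs in the RA system.\<close>

definition Qbar :: "('n::finite \<Rightarrow> nat) \<Rightarrow> nat \<Rightarrow> nat" where
  "Qbar q i = card {n. q n \<ge> i}"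

definition Qbar_plus :: "('n::finite \<Rightarrow> nat) \<Rightarrow> nat \<Rightarrow> nat" where
  "Qbar_plus q m = (\<Sum>\<^sub>\<infinity>i\<in>{m..}. Qbar q i)"

text \<open>
  The processes are families \<open>X m t\<close> with \<open>m \<ge> 1\<close> and \<open>t \<ge> 0\<close>, and their law is a measure on the
  product \<open>\<sigma>\<close>-algebra.
\<close>

definition process_law :: "'w measure \<Rightarrow> (nat \<Rightarrow> real \<Rightarrow> 'w \<Rightarrow> nat) \<Rightarrow> (nat \<times> real \<Rightarrow> nat) measure"
  where
  "process_law M X =
     distr M (Pi\<^sub>M ({1..} \<times> {0..}) (\<lambda>_. count_space UNIV))
       (\<lambda>\<omega>. \<lambda>(m, t)\<in>{1..} \<times> {0..}. X m t \<omega>)"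

text \<open>
  A copy has the same law and right-continuous paths.  Path regularity is not determined by the law
  on the product \<open>\<sigma>\<close>-algebra; without it, a statement on all \<open>t\<close> simultaneously could be arranged
  by changing a process on a null set for each \<open>t\<close> separately.
\<close>

definition copy_of_process ::
    "'v measure \<Rightarrow> (nat \<Rightarrow> real \<Rightarrow> 'v \<Rightarrow> nat) \<Rightarrow> 'w measure \<Rightarrow> (nat \<Rightarrow> real \<Rightarrow> 'w \<Rightarrow> nat) \<Rightarrow> bool"
  where
  "copy_of_process M' X' M X \<longleftrightarrow>
     (\<forall>m\<ge>1. \<forall>t\<ge>0. X' m t \<in> measurable M' (count_space UNIV)) \<and>
     (\<forall>m\<ge>1. right_continuous_paths M' (X' m)) \<and>
     process_law M' X' = process_law M X"

text \<open>
  The type of the sample points of the coupling is that of pairs of paths.  This is no restriction: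
  a coupling on any probability space can be transported along the map taking a sample point to
  its pair of paths, with the \<open>\<sigma>\<close>-algebra of all sets having measurable preimage.
\<close>

definition process_st_le ::
    "'w1 measure \<Rightarrow> (nat \<Rightarrow> real \<Rightarrow> 'w1 \<Rightarrow> nat) \<Rightarrow>
     'w2 measure \<Rightarrow> (nat \<Rightarrow> real \<Rightarrow> 'w2 \<Rightarrow> nat) \<Rightarrow> bool" where
  "process_st_le M1 X M2 Y \<longleftrightarrow>
     (\<exists>(M :: ((nat \<Rightarrow> real \<Rightarrow> nat) \<times> (nat \<Rightarrow> real \<Rightarrow> nat)) measure) X' Y'.
        prob_space M \<and> copy_of_process M X' M1 X \<and> copy_of_process M Y' M2 Y \<and>
        (AE \<omega> in M. \<forall>m\<ge>1. \<forall>t\<ge>0. X' m t \<omega> \<le> Y' m t \<omega>))"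

end

theory Submission
  imports Defs
begin

text \<open>
  Both systems are run as one jump chain on pairs of states. At every instant the \<open>k\<close>-th longest
  queue of the affinity system (in type I jobs) is matched with the \<open>k\<close>-th longest RA queue, and
  matched servers complete jobs simultaneously. An arrival with selection \<open>S\<close> picks a server
  \<open>n \<in> S\<close> with the optimal probability \<open>p\<^sub>S\<^sub>n\<close> and is sent to the RA server matched with \<open>n\<close>;
  since the load of \<open>n\<close> is at most \<open>\<lambda>\<^sub>0\<close>, extra RA arrivals bring the rate at each RA server up
  to exactly \<open>\<lambda>\<^sub>0\<close>. The affinity system adds a type I job, if at all, to a server of \<open>S\<close> with the
  fewest type I jobs, hence to a queue at most as long as that of \<open>n\<close>, so every event preserves
  the order of the tail sums \<open>\<Sum>i\<ge>m. Q\<^sub>i\<close>.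

  The joint chain has bounded rates and is built by uniformization from independent exponential
  holding times; conditioning on the first jump shows that each component is a Markov process with
  the required generator, and the generator determines the law.
\<close>

subsection \<open>Uniformized jump chains\<close>

text \<open>Queues cannot be compared server by server: even queues of equal rank need not be
  ordered, so an arrival may join an affinity queue longer than the RA queue that receives the
  coupled job. The tail sums survive because their order is weak submajorization: wherever an event
  would favor the wrong side, the matching yields a strict inequality between the counts Q_i, which
  pays for the difference of one job. The matching is recomputed in every state; RA servers are
  exchangeable, so permuting them leaves the RA rates intact. Neither component steers the other:
  summing out the assignment probabilities leaves the affinity rates, summing out the allocation
  leaves the RA rates. This is Dynkin's criterion for a function of a Markov chain to be Markov, so
  the Markov property is proved once, for a lumped chain, and used for both projections. The given
  systems live on arbitrary probability spaces and are known only through their generators. Hence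
  the proof also needs uniqueness of the law and a transport of the coupling to the space of pairs
  of paths, where events about all times at once raise measurability problems.\<close>

locale jump_chain =
  fixes K :: "'s::countable \<Rightarrow> 's pmf" and L :: real
  assumes L_pos: "0 < L"
begin

definition holding :: "real measure" where
  "holding = density lborel (exponential_density L)"

text \<open>
  A kick proposes a successor for every state at once, so that one i.i.d. sequence drives the chain
  from all initial states.
\<close>

definition kicks :: "('s \<Rightarrow> 's) measure" where
  "kicks = (\<Pi>\<^sub>M x\<in>UNIV. measure_pmf (K x))"

definition driver :: "(real \<times> ('s \<Rightarrow> 's)) stream measure" where
  "driver = stream_space (holding \<Otimes>\<^sub>M kicks)"

text \<open>In terms of partial sums of the holding times: the first \<open>k\<close> are at most
  \<open>t\<close> and the next one exceeds \<open>t\<close>. Peeling off the first step gives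
  pathwise identities for holding times of any sign; the strict inequality makes paths
  right-continuous.\<close>

primrec jumps :: "nat \<Rightarrow> real \<Rightarrow> (real \<times> ('s \<Rightarrow> 's)) stream \<Rightarrow> bool" where
  "jumps 0 t \<omega> \<longleftrightarrow> t < fst (shd \<omega>)"
| "jumps (Suc k) t \<omega> \<longleftrightarrow> fst (shd \<omega>) \<le> t \<and> jumps k (t - fst (shd \<omega>)) (stl \<omega>)"

primrec chain :: "nat \<Rightarrow> 's \<Rightarrow> (real \<times> ('s \<Rightarrow> 's)) stream \<Rightarrow> 's" where
  "chain 0 x \<omega> = x"
| "chain (Suc k) x \<omega> = chain k (snd (shd \<omega>) x) (stl \<omega>)"

text \<open>The default is taken when no partial sum of the holding times exceeds \<open>t\<close>,
  which \<open>AE_all_jumps\<close> shows to be a null event.\<close>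

definition process :: "'s \<Rightarrow> real \<Rightarrow> (real \<times> ('s \<Rightarrow> 's)) stream \<Rightarrow> 's" where
  "process x t \<omega> = (if \<exists>k. jumps k t \<omega> then chain (LEAST k. jumps k t \<omega>) x \<omega> else undefined)"

section \<open>Pathwise properties of the jump process\<close>

lemma jumps_unique: "jumps k t \<omega> \<Longrightarrow> jumps k' t \<omega> \<Longrightarrow> k = k'"
proof (induction k arbitrary: k' t \<omega>)
  case 0
  then show ?case by (cases k') auto
next
  case (Suc k)
  then show ?case by (cases k') auto
qed

lemma process_eq: "jumps k t \<omega> \<Longrightarrow> process x t \<omega> = chain k x \<omega>"
  unfolding process_def by (metis (mono_tags) LeastI jumps_unique)

text \<open>True at every sample point: if the tail has no jump count at the shifted time, both
  sides are the same \<open>undefined\<close>. Every conditioning on the first jump rests on this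
  identity.\<close>

lemma process_Stream:
  "process x t ((s, u) ## \<omega>) = (if t < s then x else process (u x) (t - s) \<omega>)"
proof (cases "t < s")
  case True
  then show ?thesis by (simp add: process_eq[of 0])
next
  case False
  show ?thesis
  proof (cases "\<exists>k. jumps k (t - s) \<omega>")
    case True
    then obtain k where "jumps k (t - s) \<omega>" by blast
    with False show ?thesis
      by (simp add: process_eq[of k] process_eq[of "Suc k"])
  next
    case no: False
    have "\<not> (\<exists>k. jumps k t ((s, u) ## \<omega>))"
    proof
      assume "\<exists>k. jumps k t ((s, u) ## \<omega>)"
      then obtain k where "jumps k t ((s, u) ## \<omega>)" by blast
      with False no show False by (cases k) auto
    qed
    with False no show ?thesis by (simp add: process_def)
  qed
qed

lemma jumps_at_right: "jumps k t \<omega> \<Longrightarrow> eventually (\<lambda>s. jumps k s \<omega>) (at_right t)"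
proof (induction k arbitrary: t \<omega>)
  case 0
  then show ?case
    using eventually_at_right_real[of t "fst (shd \<omega>)"] by (auto elim: eventually_mono)
next
  case (Suc k)
  let ?a = "fst (shd \<omega>)"
  have "eventually (\<lambda>s. jumps k s (stl \<omega>)) (at_right (t - ?a))"
    using Suc by simp
  then obtain b where b: "b > t - ?a" "\<And>y. t - ?a < y \<Longrightarrow> y < b \<Longrightarrow> jumps k y (stl \<omega>)"
    unfolding eventually_at_right_field by blast
  show ?case
    unfolding eventually_at_right_field
    using b Suc.prems by (intro exI[of _ "b + ?a"]) auto
qed

lemma process_at_right:
  "jumps k t \<omega> \<Longrightarrow> eventually (\<lambda>s. process x s \<omega> = process x t \<omega>) (at_right t)"
  using jumps_at_right[of k t \<omega>] by (auto elim!: eventually_mono simp: process_eq)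

lemma jumps_earlier:
  "jumps k t \<omega> \<Longrightarrow> s \<le> t \<Longrightarrow> \<exists>j. jumps j s \<omega>"
proof (induction k arbitrary: s t \<omega>)
  case 0
  then have "jumps 0 s \<omega>" by simp
  then show ?case by blast
next
  case (Suc k)
  show ?case
  proof (cases "s < fst (shd \<omega>)")
    case True
    then have "jumps 0 s \<omega>" by simp
    then show ?thesis by blast
  next
    case False
    obtain j where "jumps j (s - fst (shd \<omega>)) (stl \<omega>)"
      using Suc.IH[of "t - fst (shd \<omega>)" "stl \<omega>" "s - fst (shd \<omega>)"] Suc.prems by auto
    with False have "jumps (Suc j) s \<omega>" by simp
    then show ?thesis by blast
  qed
qed

section \<open>Measurability and conditioning on the first step\<close>

lemma prob_space_holding: "prob_space holding"
  unfolding holding_def by (rule prob_space_exponential_density[OF L_pos])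

lemma sets_holding [simp, measurable_cong]: "sets holding = sets borel"
  by (simp add: holding_def)

lemma space_holding [simp]: "space holding = UNIV"
  by (simp add: holding_def)

lemma prob_space_kicks: "prob_space kicks"
  unfolding kicks_def by (intro prob_space_PiM measure_pmf.prob_space_axioms)

lemma space_kicks [simp]: "space kicks = UNIV"
  by (simp add: kicks_def space_PiM)

lemma measurable_kick [measurable]: "(\<lambda>u. u x) \<in> measurable kicks (count_space UNIV)"
proof -
  have "(\<lambda>u. u x) \<in> measurable kicks (measure_pmf (K x))"
    unfolding kicks_def by (rule measurable_component_singleton) simp
  then show ?thesis by simp
qed

lemma distr_kick: "distr kicks (count_space UNIV) (\<lambda>u. u x) = measure_pmf (K x)"
proof -
  have "distr kicks (count_space UNIV) (\<lambda>u. u x) = distr kicks (measure_pmf (K x)) (\<lambda>u. u x)"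
    by (rule distr_cong) auto
  also have "\<dots> = measure_pmf (K x)"
    unfolding kicks_def by (rule distr_PiM_component) (auto intro: measure_pmf.prob_space_axioms)
  finally show ?thesis .
qed

lemma prob_space_step: "prob_space (holding \<Otimes>\<^sub>M kicks)"
  using prob_space_holding prob_space_kicks by (rule prob_space_pair)

lemma prob_space_driver: "prob_space driver"
  unfolding driver_def by (rule prob_space.prob_space_stream_space[OF prob_space_step])

lemma space_driver [simp]: "space driver = UNIV"
  by (simp add: driver_def space_stream_space space_pair_measure)

lemma measurable_fst_shd [measurable]: "(\<lambda>\<omega>. fst (shd \<omega>)) \<in> borel_measurable driver"
  unfolding driver_def by measurable

lemma measurable_stl_driver [measurable]: "stl \<in> measurable driver driver"
  unfolding driver_def by measurable

lemma measurable_snd_shd [measurable]: "(\<lambda>\<omega>. snd (shd \<omega>) x) \<in> measurable driver (count_space UNIV)"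
  unfolding driver_def
  by (rule measurable_compose[OF _ measurable_kick]) measurable

lemma measurable_Stream_driver [measurable]:
  "(\<lambda>\<omega>. (s, u) ## \<omega>) \<in> measurable driver driver"
  unfolding driver_def by (rule measurable_Stream) (auto simp: space_pair_measure)

lemma measurable_chain [measurable]: "(\<lambda>\<omega>. chain k x \<omega>) \<in> measurable driver (count_space UNIV)"
proof (induction k arbitrary: x)
  case 0
  have "chain 0 x = (\<lambda>_. x)" by (simp add: fun_eq_iff)
  then show ?case by simp
next
  case (Suc k)
  note Suc [measurable]
  show ?case
    unfolding chain.simps
    by (rule measurable_compose_countable[where f="\<lambda>y \<omega>. chain k y (stl \<omega>)"]) measurable
qed

text \<open>The induction needs joint measurability in time and path, since the recursion evaluates
  the tail at a random time.\<close>

lemma measurable_jumps_pair: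
  "Measurable.pred (borel \<Otimes>\<^sub>M driver) (\<lambda>p. jumps k (fst p) (snd p))"
proof (induction k)
  case (Suc k)
  have [measurable]: "(\<lambda>p. (fst p - fst (shd (snd p)), stl (snd p)))
      \<in> measurable (borel \<Otimes>\<^sub>M driver) (borel \<Otimes>\<^sub>M driver)"
    by measurable
  have "Measurable.pred (borel \<Otimes>\<^sub>M driver) (\<lambda>p. jumps k (fst p - fst (shd (snd p))) (stl (snd p)))"
    using measurable_compose[OF _ Suc, of "\<lambda>p. (fst p - fst (shd (snd p)), stl (snd p))"] by simp
  then show ?case by simp
qed simp

lemma measurable_jumps [measurable]: "Measurable.pred driver (jumps k t)"
  using measurable_compose[OF _ measurable_jumps_pair[of k], of "\<lambda>\<omega>. (t, \<omega>)" driver] by simp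

lemma measurable_process [measurable]: "process x t \<in> measurable driver (count_space UNIV)"
proof -
  have [measurable]: "(\<lambda>\<omega>. chain (LEAST k. jumps k t \<omega>) x \<omega>) \<in> measurable driver (count_space UNIV)"
    by (rule measurable_compose_countable[where f="\<lambda>k \<omega>. chain k x \<omega>"]) measurable
  show ?thesis unfolding process_def by measurable
qed

text \<open>By \<open>dep\<close> only the value at \<open>x\<close> of the first kick matters, so
  the kick integrates out to its marginal \<open>K x\<close>, and a constant function can represent
  it. The second claim lets the inner integral be integrated further over the holding time.\<close>

lemma emeasure_first_step:
  assumes P [measurable]: "Measurable.pred driver P"
    and dep: "\<And>s u \<omega>. P ((s, u) ## \<omega>) = P ((s, \<lambda>_. u x) ## \<omega>)"
  shows "emeasure driver {\<omega>. P \<omega>} =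
    (\<integral>\<^sup>+s. \<integral>\<^sup>+y. emeasure driver {\<omega>. P ((s, \<lambda>_. y) ## \<omega>)} \<partial>measure_pmf (K x) \<partial>holding)"
    and "(\<lambda>s. \<integral>\<^sup>+y. emeasure driver {\<omega>. P ((s, \<lambda>_. y) ## \<omega>)} \<partial>measure_pmf (K x)) \<in> borel_measurable borel"
proof -
  interpret H: prob_space holding by (rule prob_space_holding)
  interpret U: prob_space kicks by (rule prob_space_kicks)
  interpret HU: prob_space "holding \<Otimes>\<^sub>M kicks" by (rule prob_space_step)
  interpret D: prob_space driver by (rule prob_space_driver)
  have [measurable]: "{\<omega>. P \<omega>} \<in> sets driver" using P by (simp add: pred_def)
  have [measurable]: "(\<lambda>p. emeasure driver {\<omega>. P (p ## \<omega>)}) \<in> borel_measurable (holding \<Otimes>\<^sub>M kicks)"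
  proof -
    have "(\<lambda>p. emeasure driver (Pair p -` {q\<in>space ((holding \<Otimes>\<^sub>M kicks) \<Otimes>\<^sub>M driver). P (fst q ## snd q)}))
       \<in> borel_measurable (holding \<Otimes>\<^sub>M kicks)"
    proof (rule D.measurable_emeasure_Pair)
      have "(\<lambda>q. fst q ## snd q) \<in> measurable ((holding \<Otimes>\<^sub>M kicks) \<Otimes>\<^sub>M driver) driver"
        unfolding driver_def by measurable
      from measurable_compose[OF this P]
      show "{q\<in>space ((holding \<Otimes>\<^sub>M kicks) \<Otimes>\<^sub>M driver). P (fst q ## snd q)} \<in> sets ((holding \<Otimes>\<^sub>M kicks) \<Otimes>\<^sub>M driver)"
        by (simp add: pred_def)
    qed
    then show ?thesis by (simp add: space_pair_measure vimage_def)
  qed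
  have eq: "(\<integral>\<^sup>+u. emeasure driver {\<omega>. P ((s, u) ## \<omega>)} \<partial>kicks) =
      (\<integral>\<^sup>+y. emeasure driver {\<omega>. P ((s, \<lambda>_. y) ## \<omega>)} \<partial>measure_pmf (K x))" for s
  proof -
    have "(\<integral>\<^sup>+u. emeasure driver {\<omega>. P ((s, u) ## \<omega>)} \<partial>kicks) =
      (\<integral>\<^sup>+u. (\<lambda>y. emeasure driver {\<omega>. P ((s, \<lambda>_. y) ## \<omega>)}) (u x) \<partial>kicks)"
      by (subst dep) simp
    also have "\<dots> = (\<integral>\<^sup>+y. emeasure driver {\<omega>. P ((s, \<lambda>_. y) ## \<omega>)} \<partial>distr kicks (count_space UNIV) (\<lambda>u. u x))"
      by (rule nn_integral_distr[symmetric]) auto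
    finally show ?thesis by (simp only: distr_kick)
  qed
  have "emeasure driver {\<omega>. P \<omega>} = (\<integral>\<^sup>+p. emeasure driver {\<omega>. P (p ## \<omega>)} \<partial>(holding \<Otimes>\<^sub>M kicks))"
    using HU.emeasure_stream_space[of "{\<omega>. P \<omega>}"] P
    by (simp add: driver_def[symmetric] pred_def)
  also have "\<dots> = (\<integral>\<^sup>+s. \<integral>\<^sup>+u. emeasure driver {\<omega>. P ((s, u) ## \<omega>)} \<partial>kicks \<partial>holding)"
    by (rule U.nn_integral_fst[symmetric]) measurable
  finally show "emeasure driver {\<omega>. P \<omega>} =
    (\<integral>\<^sup>+s. \<integral>\<^sup>+y. emeasure driver {\<omega>. P ((s, \<lambda>_. y) ## \<omega>)} \<partial>measure_pmf (K x) \<partial>holding)"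
    by (simp only: eq)
  have "(\<lambda>s. \<integral>\<^sup>+u. emeasure driver {\<omega>. P ((s, u) ## \<omega>)} \<partial>kicks) \<in> borel_measurable holding"
    by (rule U.borel_measurable_nn_integral_fst[where f="\<lambda>p. emeasure driver {\<omega>. P (p ## \<omega>)}"]) measurable
  then show "(\<lambda>s. \<integral>\<^sup>+y. emeasure driver {\<omega>. P ((s, \<lambda>_. y) ## \<omega>)} \<partial>measure_pmf (K x)) \<in> borel_measurable borel"
    by (simp add: eq cong: measurable_cong_sets)
qed

section \<open>Poisson law of the number of jumps\<close>

definition pois :: "nat \<Rightarrow> real \<Rightarrow> real" where
  "pois k t = exp (- (L * t)) * ((L * t) ^ k / fact k)"

lemma pois_nonneg: "0 \<le> t \<Longrightarrow> 0 \<le> pois k t"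
  using L_pos by (simp add: pois_def)

lemma holding_memoryless:
  assumes [measurable]: "g \<in> borel_measurable borel" and t: "0 \<le> t"
  shows "(\<integral>\<^sup>+s. (if t < s then g (s - t) else 0) \<partial>holding) = ennreal (exp (- (L * t))) * (\<integral>\<^sup>+s. g s \<partial>holding)"
proof -
  have "(\<integral>\<^sup>+s. (if t < s then g (s - t) else 0) \<partial>holding) =
      (\<integral>\<^sup>+s. ennreal (exponential_density L s) * (if t < s then g (s - t) else 0) \<partial>lborel)"
    unfolding holding_def by (rule nn_integral_density) auto
  also have "\<dots> = (\<integral>\<^sup>+r. ennreal (exponential_density L (t + r)) * (if 0 < r then g r else 0) \<partial>lborel)"
    by (subst nn_integral_real_affine[where c=1 and t=t]) (auto cong: if_cong)
  \<comment> \<open>At \<open>r = 0\<close> the integrands may differ, as the strict indicator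
    vanishes and the density does not; a single point is null.\<close>
  also have "\<dots> = (\<integral>\<^sup>+r. ennreal (exp (- (L * t))) * (ennreal (exponential_density L r) * g r) \<partial>lborel)"
  proof (rule nn_integral_cong_AE)
    have "ennreal (exponential_density L (t + r)) * (if 0 < r then g r else 0)
        = ennreal (exp (- (L * t))) * (ennreal (exponential_density L r) * g r)" if "r \<noteq> 0" for r
    proof (cases "0 < r")
      case True
      have "exponential_density L (t + r) = exp (- (L * t)) * exponential_density L r"
        using True t by (simp add: exponential_density_def exp_add[symmetric] algebra_simps)
      with True L_pos show ?thesis
        by (simp add: ennreal_mult exponential_density_nonneg mult.assoc)
    next
      case False
      with that show ?thesis by (simp add: exponential_density_def)
    qed
    then show "AE r in lborel. ennreal (exponential_density L (t + r)) * (if 0 < r then g r else 0)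
        = ennreal (exp (- (L * t))) * (ennreal (exponential_density L r) * g r)"
      by (rule eventually_mono[OF AE_lborel_singleton[of 0]])
  qed
  also have "\<dots> = ennreal (exp (- (L * t))) * (\<integral>\<^sup>+r. ennreal (exponential_density L r) * g r \<partial>lborel)"
    by (rule nn_integral_cmult) auto
  also have "(\<integral>\<^sup>+r. ennreal (exponential_density L r) * g r \<partial>lborel) = (\<integral>\<^sup>+s. g s \<partial>holding)"
    unfolding holding_def by (rule nn_integral_density[symmetric]) auto
  finally show ?thesis .
qed

text \<open>This is the convolution step from \<open>k\<close> to \<open>Suc k\<close> jumps. The
  two exponential factors combine to exp (- L t), independent of \<open>s\<close>, so only a
  polynomial remains to be integrated.\<close>

lemma holding_pois:
  assumes t: "0 \<le> t"
  shows "(\<integral>\<^sup>+s. (if s \<le> t then ennreal (pois k (t - s)) else 0) \<partial>holding) = ennreal (pois (Suc k) t)"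
proof -
  let ?F = "\<lambda>s. - exp (- (L * t)) * ((L * (t - s)) ^ Suc k / fact (Suc k))"
  let ?f = "\<lambda>s. exp (- (L * t)) * L * ((L * (t - s)) ^ k / fact k)"
  have [measurable]: "(\<lambda>s. pois k (t - s)) \<in> borel_measurable borel"
    unfolding pois_def by measurable
  have "(\<integral>\<^sup>+s. (if s \<le> t then ennreal (pois k (t - s)) else 0) \<partial>holding) =
      (\<integral>\<^sup>+s. ennreal (exponential_density L s) * (if s \<le> t then ennreal (pois k (t - s)) else 0) \<partial>lborel)"
    unfolding holding_def by (rule nn_integral_density) auto
  also have "\<dots> = (\<integral>\<^sup>+s. ennreal (?f s) * indicator {0..t} s \<partial>lborel)"
  proof (rule nn_integral_cong)
    fix s :: real
    show "ennreal (exponential_density L s) * (if s \<le> t then ennreal (pois k (t - s)) else 0)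
        = ennreal (?f s) * indicator {0..t} s"
    proof (cases "0 \<le> s \<and> s \<le> t")
      case True
      have "exponential_density L s * pois k (t - s) = ?f s"
      proof -
        have "exponential_density L s * pois k (t - s)
            = (exp (- (s * L)) * exp (- (L * (t - s)))) * L * ((L * (t - s)) ^ k / fact k)"
          using True by (simp add: exponential_density_def pois_def)
        also have "exp (- (s * L)) * exp (- (L * (t - s))) = exp (- (L * t))"
          by (simp add: exp_add[symmetric] algebra_simps)
        finally show ?thesis .
      qed
      with True L_pos show ?thesis
        by (simp add: ennreal_mult[symmetric] exponential_density_nonneg pois_nonneg)
    next
      case False
      then show ?thesis by (auto simp: exponential_density_def)
    qed
  qed
  also have "\<dots> = ennreal (?F t - ?F 0)"
  proof (rule nn_integral_FTC_Icc[where F="?F" and f="?f", OF _ _ _ t])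
    fix s assume "s \<in> {0..t}"
    have "((\<lambda>s. - exp (- (L * t)) * ((L * (t - s)) ^ Suc k / fact (Suc k)))
      has_real_derivative - exp (- (L * t)) * ((real (Suc k) * (L * (t - s)) ^ k * (L * (0 - 1))) / fact (Suc k))) (at s)"
      by (rule derivative_eq_intros refl | simp)+
    also have "- exp (- (L * t)) * ((real (Suc k) * (L * (t - s)) ^ k * (L * (0 - 1))) / fact (Suc k)) = ?f s"
      by (simp add: field_simps del: of_nat_Suc)
    finally show "(?F has_real_derivative ?f s) (at s)" .
  next
    show "0 \<le> ?f s" if "s \<in> {0..t}" for s using that L_pos by simp
  qed simp
  also have "?F t - ?F 0 = pois (Suc k) t" by (simp add: pois_def)
  finally show ?thesis .
qed

lemma emeasure_driver_UNIV [simp]: "emeasure driver UNIV = 1"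
  using prob_space.emeasure_space_1[OF prob_space_driver] by simp

text \<open>Induction over the first jump. Jump counts ignore the states, so the state at which the
  first kick is evaluated is arbitrary; hence \<open>K undefined\<close>.\<close>

lemma emeasure_jumps: "0 \<le> t \<Longrightarrow> emeasure driver {\<omega>. jumps k t \<omega>} = ennreal (pois k t)"
proof (induction k arbitrary: t)
  case 0
  have "emeasure driver {\<omega>. jumps 0 t \<omega>} =
     (\<integral>\<^sup>+s. \<integral>\<^sup>+y. emeasure driver {\<omega>. jumps 0 t ((s, \<lambda>_. y) ## \<omega>)} \<partial>measure_pmf (K undefined) \<partial>holding)"
    by (rule emeasure_first_step(1)[OF measurable_jumps]) simp
  also have "\<dots> = (\<integral>\<^sup>+s. (if t < s then (\<lambda>_. 1) (s - t) else 0) \<partial>holding)"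
    by (rule nn_integral_cong) (auto simp: measure_pmf.emeasure_space_1[simplified])
  also have "\<dots> = ennreal (pois 0 t)"
    using prob_space.emeasure_space_1[OF prob_space_holding]
    by (subst holding_memoryless[OF _ 0]) (auto simp: pois_def)
  finally show ?case .
next
  case (Suc k)
  have "emeasure driver {\<omega>. jumps (Suc k) t \<omega>} =
     (\<integral>\<^sup>+s. \<integral>\<^sup>+y. emeasure driver {\<omega>. jumps (Suc k) t ((s, \<lambda>_. y) ## \<omega>)} \<partial>measure_pmf (K undefined) \<partial>holding)"
    by (rule emeasure_first_step(1)[OF measurable_jumps]) simp
  also have "\<dots> = (\<integral>\<^sup>+s. (if s \<le> t then ennreal (pois k (t - s)) else 0) \<partial>holding)"
    by (rule nn_integral_cong) (auto simp: Suc.IH measure_pmf.emeasure_space_1[simplified])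
  finally show ?case by (simp add: holding_pois[OF Suc.prems])
qed

lemma pois_sums: "(\<lambda>k. pois k t) sums 1"
proof -
  have "(\<lambda>k. (L * t) ^ k / fact k) sums exp (L * t)"
    using exp_converges[of "L * t"] by (simp add: divide_real_def mult.commute)
  from sums_mult[OF this, of "exp (- (L * t))"] show ?thesis
    by (simp add: pois_def exp_minus)
qed

lemma emeasure_split_jumps:
  assumes [measurable]: "Measurable.pred driver P"
  shows "emeasure driver {\<omega>. \<exists>k. jumps k t \<omega> \<and> P \<omega>} = (\<Sum>k. emeasure driver {\<omega>. jumps k t \<omega> \<and> P \<omega>})"
proof -
  have "{\<omega>. jumps k t \<omega> \<and> P \<omega>} \<in> sets driver" for k
  proof -
    have "Measurable.pred driver (\<lambda>\<omega>. jumps k t \<omega> \<and> P \<omega>)" by measurable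
    then show ?thesis by (simp add: pred_def)
  qed
  then have "(\<Sum>k. emeasure driver {\<omega>. jumps k t \<omega> \<and> P \<omega>}) = emeasure driver (\<Union>k. {\<omega>. jumps k t \<omega> \<and> P \<omega>})"
    by (intro suminf_emeasure) (auto simp: disjoint_family_on_def dest: jumps_unique)
  also have "(\<Union>k. {\<omega>. jumps k t \<omega> \<and> P \<omega>}) = {\<omega>. \<exists>k. jumps k t \<omega> \<and> P \<omega>}" by auto
  finally show ?thesis ..
qed

text \<open>No explosion, because the Poisson probabilities sum to 1.\<close>

lemma AE_jumps:
  assumes "0 \<le> t"
  shows "AE \<omega> in driver. \<exists>k. jumps k t \<omega>"
proof -
  interpret prob_space driver by (rule prob_space_driver)
  have "emeasure driver {\<omega>. \<exists>k. jumps k t \<omega> \<and> True} = (\<Sum>k. ennreal (pois k t))"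
    by (subst emeasure_split_jumps) (auto simp: emeasure_jumps assms)
  also have "\<dots> = 1"
    using pois_sums[of t] by (subst suminf_ennreal2) (auto simp: sums_iff pois_nonneg[OF assms])
  finally have "emeasure driver {\<omega>\<in>space driver. \<exists>k. jumps k t \<omega>} = 1" by simp
  then show ?thesis
    by (subst AE_iff_emeasure_eq_1) (auto simp: emeasure_space_1)
qed

text \<open>The exceptional null set is made independent of \<open>t\<close> by using integer times
  only: a jump count at one time yields one at every earlier time.\<close>

lemma AE_all_jumps: "AE \<omega> in driver. \<forall>t. \<exists>k. jumps k t \<omega>"
proof -
  have "AE \<omega> in driver. \<forall>n::nat. \<exists>k. jumps k (real n) \<omega>"
    by (subst AE_all_countable) (simp add: AE_jumps)
  then show ?thesis
  proof (rule eventually_mono, intro allI)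
    fix \<omega> and t :: real assume *: "\<forall>n::nat. \<exists>k. jumps k (real n) \<omega>"
    obtain n :: nat where "t \<le> real n" using real_arch_simple by blast
    with * show "\<exists>k. jumps k t \<omega>" using jumps_earlier by blast
  qed
qed

text \<open>Splits an event by the number of jumps up to \<open>t\<close>, which turns claims about
  time \<open>t\<close> into inductions on that number.\<close>

lemma emeasure_sum_jumps:
  assumes [measurable]: "Measurable.pred driver P" and t: "0 \<le> t"
  shows "emeasure driver {\<omega>. P \<omega>} = (\<Sum>k. emeasure driver {\<omega>. jumps k t \<omega> \<and> P \<omega>})"
proof -
  have "emeasure driver {\<omega>\<in>space driver. P \<omega>} = emeasure driver {\<omega>\<in>space driver. \<exists>k. jumps k t \<omega> \<and> P \<omega>}"
  proof (rule emeasure_eq_AE)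
    show "AE \<omega> in driver. (\<omega> \<in> {\<omega>\<in>space driver. P \<omega>}) = (\<omega> \<in> {\<omega>\<in>space driver. \<exists>k. jumps k t \<omega> \<and> P \<omega>})"
      using AE_jumps[OF t] by eventually_elim auto
  qed measurable
  then show ?thesis by (simp only: emeasure_split_jumps[OF assms(1)] space_driver UNIV_I simp_thms)
qed

section \<open>Almost sure path properties\<close>

lemma AE_process_right_continuous:
  "AE \<omega> in driver. \<forall>t. eventually (\<lambda>s. process x s \<omega> = process x t \<omega>) (at_right t)"
  using AE_all_jumps
proof (rule eventually_mono, intro allI)
  fix \<omega> t assume "\<forall>t. \<exists>k. jumps k t \<omega>"
  then obtain k where "jumps k t \<omega>" by blast
  then show "eventually (\<lambda>s. process x s \<omega> = process x t \<omega>) (at_right t)"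
    by (rule process_at_right)
qed

lemma AE_kicks: "AE u in kicks. \<forall>x. u x \<in> set_pmf (K x)"
proof (subst AE_all_countable, rule allI)
  fix x
  have "AE y in distr kicks (count_space UNIV) (\<lambda>u. u x). y \<in> set_pmf (K x)"
    unfolding distr_kick by (rule AE_measure_pmf)
  then show "AE u in kicks. u x \<in> set_pmf (K x)"
    by (subst (asm) AE_distr_iff) auto
qed

text \<open>Almost surely all kicks, at all steps and all states, land in the supports; these are
  countably many conditions. On that event the embedded chain never leaves \<open>I\<close>, which
  settles all times at once.\<close>

lemma AE_process_invariant:
  assumes I: "x \<in> I" "\<And>y. y \<in> I \<Longrightarrow> set_pmf (K y) \<subseteq> I"
  shows "AE \<omega> in driver. \<forall>t. process x t \<omega> \<in> I"
proof -
  interpret HU: prob_space "holding \<Otimes>\<^sub>M kicks" by (rule prob_space_step)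
  interpret H: prob_space holding by (rule prob_space_holding)
  interpret U: prob_space kicks by (rule prob_space_kicks)
  interpret P: pair_sigma_finite holding kicks ..
  have [measurable]: "(\<lambda>p. snd p x) \<in> measurable (holding \<Otimes>\<^sub>M kicks) (count_space UNIV)" for x
    by (rule measurable_compose[OF measurable_snd measurable_kick])
  have "AE p in holding \<Otimes>\<^sub>M kicks. \<forall>x. snd p x \<in> set_pmf (K x)"
  proof (rule P.AE_pair_measure)
    show "AE s in holding. AE u in kicks. \<forall>x. snd (s, u) x \<in> set_pmf (K x)"
      using AE_kicks by simp
  qed measurable
  then have "AE \<omega> in driver. stream_all (\<lambda>p. \<forall>x. snd p x \<in> set_pmf (K x)) \<omega>"
    unfolding driver_def by (intro HU.AE_stream_all) auto
  moreover have chain_I: "chain k y \<omega> \<in> I"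
    if "stream_all (\<lambda>p. \<forall>x. snd p x \<in> set_pmf (K x)) \<omega>" "y \<in> I" for k y \<omega>
    using that
  proof (induction k arbitrary: y \<omega>)
    case (Suc k)
    have "snd (shd \<omega>) y \<in> I"
      using Suc.prems I(2) by (cases \<omega>) auto
    moreover have "stream_all (\<lambda>p. \<forall>x. snd p x \<in> set_pmf (K x)) (stl \<omega>)"
      using Suc.prems(1) by (cases \<omega>) auto
    ultimately show ?case using Suc.IH by simp
  qed simp
  ultimately have "AE \<omega> in driver. \<forall>k. chain k x \<omega> \<in> I"
    using I(1) by (auto elim!: eventually_mono)
  then show ?thesis
    using AE_all_jumps by eventually_elim (metis process_eq)
qed

end

subsection \<open>The Markov property\<close>

text \<open>With \<open>q i\<close> in the role of P^i f, the sums expand powers of P - I, and the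
  identity reads (P - I)^(k+1) = (P - I)^k P - (P - I)^k. It is Pascal's rule.\<close>

lemma alternating_binomial_Suc:
  fixes q :: "nat \<Rightarrow> real"
  shows "(\<Sum>i\<le>Suc k. real (Suc k choose i) * (-1) ^ (Suc k - i) * q i) =
    (\<Sum>i\<le>k. real (k choose i) * (-1) ^ (k - i) * q (Suc i)) -
    (\<Sum>i\<le>k. real (k choose i) * (-1) ^ (k - i) * q i)"
proof -
  \<comment> \<open>Lowering the exponent by one flips the sign only for \<open>i < k\<close>; at
    \<open>i = k\<close> natural subtraction is stuck at 0, but the binomial coefficient
    vanishes.\<close>
  have neg: "real (k choose Suc i) * (-1) ^ (k - i) = - (real (k choose Suc i) * (-1) ^ (k - Suc i))" if "i \<le> k" for i
  proof (cases "i = k")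
    case False
    with that have "k - i = Suc (k - Suc i)" by simp
    then show ?thesis by simp
  qed simp
  have "(\<Sum>i\<le>k. real (k choose i) * (-1) ^ (k - i) * q i)
      = (\<Sum>i\<le>Suc k. real (k choose i) * (-1) ^ (k - i) * q i)"
    by simp
  also have "\<dots> = (-1) ^ k * q 0 + (\<Sum>i\<le>k. real (k choose Suc i) * (-1) ^ (k - Suc i) * q (Suc i))"
    by (simp only: sum.atMost_Suc_shift) simp
  also have "(\<Sum>i\<le>k. real (k choose Suc i) * (-1) ^ (k - Suc i) * q (Suc i))
      = - (\<Sum>i\<le>k. real (k choose Suc i) * (-1) ^ (k - i) * q (Suc i))"
    by (simp add: sum_negf[symmetric] neg del: sum.atMost_Suc)
  finally have 1: "(\<Sum>i\<le>k. real (k choose i) * (-1) ^ (k - i) * q i)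
      = (-1) ^ k * q 0 - (\<Sum>i\<le>k. real (k choose Suc i) * (-1) ^ (k - i) * q (Suc i))"
    by simp
  have "(\<Sum>i\<le>Suc k. real (Suc k choose i) * (-1) ^ (Suc k - i) * q i)
      = (-1) ^ Suc k * q 0 + (\<Sum>i\<le>k. real (Suc k choose Suc i) * (-1) ^ (k - i) * q (Suc i))"
    by (simp only: sum.atMost_Suc_shift) simp
  also have "\<dots> = (-1) ^ Suc k * q 0 + (\<Sum>i\<le>k. real (k choose i) * (-1) ^ (k - i) * q (Suc i))
      + (\<Sum>i\<le>k. real (k choose Suc i) * (-1) ^ (k - i) * q (Suc i))"
    by (simp add: sum.distrib algebra_simps)
  finally show ?thesis using 1 by simp
qed

text \<open>The identity exp (t L (P - I)) = exp (- L t) exp (L t P): the semigroup is a Poisson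
  mixture of powers of \<open>P\<close>. No operator norm is involved; it is a Cauchy product of
  real series at the single point \<open>a\<close>, where \<open>bound\<close> gives absolute
  convergence.\<close>

lemma semigroup_of_uniformized:
  fixes P G :: "('a \<Rightarrow> real) \<Rightarrow> 'a \<Rightarrow> real"
  assumes G: "\<And>f a. G f a = L * (P f a - f a)"
    and add: "\<And>f g a. P (\<lambda>x. f x + g x) a = P f a + P g a"
    and scale: "\<And>c f a. P (\<lambda>x. c * f x) a = c * P f a"
    and bound: "\<And>k. \<bar>(P ^^ k) f a\<bar> \<le> 1"
  shows "(\<lambda>k. exp (- (L * t)) * ((L * t) ^ k / fact k) * (P ^^ k) f a) sums semigroup_of G t f a"
proof -
  have P_sum: "P (\<lambda>x. \<Sum>i\<in>I. c i * g i x) b = (\<Sum>i\<in>I. c i * P (g i) b)"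
    if "finite I" for I :: "nat set" and c :: "nat \<Rightarrow> real" and g b
    using that
  proof induction
    case empty
    show ?case using scale[of 0 "\<lambda>_. 0" b] by simp
  next
    case (insert i I)
    then show ?case by (simp add: add scale)
  qed
  have power: "(G ^^ k) f = (\<lambda>b. \<Sum>i\<le>k. (L ^ k * (real (k choose i) * (-1) ^ (k - i))) * (P ^^ i) f b)" for k
  proof (induction k)
    case (Suc k)
    show ?case
    proof
      fix b
      have "(G ^^ Suc k) f b = L * (P ((G ^^ k) f) b - (G ^^ k) f b)" by (simp add: G)
      also have "P ((G ^^ k) f) b = (\<Sum>i\<le>k. (L ^ k * (real (k choose i) * (-1) ^ (k - i))) * (P ^^ Suc i) f b)"
        by (simp add: Suc P_sum)
      also have "(G ^^ k) f b = (\<Sum>i\<le>k. (L ^ k * (real (k choose i) * (-1) ^ (k - i))) * (P ^^ i) f b)"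
        by (simp add: Suc)
      also have "L * ((\<Sum>i\<le>k. (L ^ k * (real (k choose i) * (-1) ^ (k - i))) * (P ^^ Suc i) f b)
          - (\<Sum>i\<le>k. (L ^ k * (real (k choose i) * (-1) ^ (k - i))) * (P ^^ i) f b))
        = L ^ Suc k * ((\<Sum>i\<le>k. real (k choose i) * (-1) ^ (k - i) * (P ^^ Suc i) f b)
          - (\<Sum>i\<le>k. real (k choose i) * (-1) ^ (k - i) * (P ^^ i) f b))"
        by (simp add: sum_distrib_left right_diff_distrib mult.assoc)
      also have "\<dots> = L ^ Suc k * (\<Sum>i\<le>Suc k. real (Suc k choose i) * (-1) ^ (Suc k - i) * (P ^^ i) f b)"
        by (simp only: alternating_binomial_Suc)
      finally show "(G ^^ Suc k) f b = (\<Sum>i\<le>Suc k. (L ^ Suc k * (real (Suc k choose i) * (-1) ^ (Suc k - i))) * (P ^^ i) f b)"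
        by (simp only: sum_distrib_left mult.assoc)
    qed
  qed simp
  \<comment> \<open>\<open>u\<close> is the series of exp (L t P) f at \<open>a\<close> and
    \<open>v\<close> that of exp (- L t); their Cauchy product is the series defining
    \<open>semigroup_of\<close>.\<close>
  define u where "u k = (L * t) ^ k / fact k * (P ^^ k) f a" for k
  define v where "v k = (- (L * t)) ^ k / fact k" for k
  have term_eq: "t ^ k / fact k * (G ^^ k) f a = (\<Sum>i\<le>k. u i * v (k - i))" for k
  proof -
    have "t ^ k / fact k * (L ^ k * (real (k choose i) * (-1) ^ (k - i)) * (P ^^ i) f a) = u i * v (k - i)"
      if "i \<le> k" for i
    proof -
      have pw: "(L * t) ^ k = (L * t) ^ i * (L * t) ^ (k - i)"
        using that by (simp add: power_add[symmetric])
      have m: "(- (L * t)) ^ (k - i) = (-1) ^ (k - i) * (L * t) ^ (k - i)"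
        by (rule power_minus)
      have "t ^ k / fact k * (L ^ k * (real (k choose i) * (-1) ^ (k - i)) * (P ^^ i) f a)
        = ((L * t) ^ k) / fact k * (fact k / (fact i * fact (k - i))) * (-1) ^ (k - i) * (P ^^ i) f a"
        using that by (simp add: binomial_fact power_mult_distrib)
      also have "\<dots> = u i * v (k - i)"
        by (simp add: u_def v_def pw m)
      finally show ?thesis .
    qed
    then show ?thesis by (simp add: power sum_distrib_left)
  qed
  have su: "summable (\<lambda>k. norm (u k))"
  proof (rule summable_comparison_test')
    show "summable (\<lambda>k. \<bar>L * t\<bar> ^ k / fact k)"
      using summable_exp[of "\<bar>L * t\<bar>"] by (simp add: field_simps)
    show "norm (norm (u k)) \<le> \<bar>L * t\<bar> ^ k / fact k" if "k \<ge> 0" for k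
    proof -
      have "norm (u k) = \<bar>L * t\<bar> ^ k / fact k * \<bar>(P ^^ k) f a\<bar>"
        by (simp add: u_def abs_mult power_abs)
      also have "\<dots> \<le> \<bar>L * t\<bar> ^ k / fact k * 1"
        by (rule mult_left_mono[OF bound]) simp
      finally show ?thesis by simp
    qed
  qed
  have v_sums: "v sums exp (- (L * t))"
    using exp_converges[of "- (L * t)"] by (simp add: v_def[abs_def] divide_real_def mult.commute)
  have sv: "summable (\<lambda>k. norm (v k))"
    using summable_norm_exp[of "- (L * t)"] by (simp add: v_def norm_divide norm_power field_simps)
  have "(\<lambda>k. \<Sum>i\<le>k. u i * v (k - i)) sums ((\<Sum>k. u k) * (\<Sum>k. v k))"
    by (rule Cauchy_product_sums[OF su sv])
  then have "semigroup_of G t f a = (\<Sum>k. u k) * exp (- (L * t))"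
    unfolding semigroup_of_def term_eq using v_sums by (simp add: sums_iff)
  moreover have "(\<lambda>k. exp (- (L * t)) * u k) sums (exp (- (L * t)) * (\<Sum>k. u k))"
    by (rule sums_mult[OF summable_sums[OF summable_norm_cancel[OF su]]])
  ultimately show ?thesis by (simp add: u_def mult_ac)
qed

text \<open>Dynkin's criterion: the mean of a function of \<open>\<pi>\<close> after one step
  depends on the present state only through \<open>\<pi> x\<close>. Surjectivity lets the step
  operator inherit linearity and bounds from the expectation at every point; finite supports make
  all functions integrable.\<close>

locale lumped_jump_chain = jump_chain K L for K :: "'s::countable \<Rightarrow> 's pmf" and L +
  fixes \<pi> :: "'s \<Rightarrow> 'a::countable" and G :: "('a \<Rightarrow> real) \<Rightarrow> 'a \<Rightarrow> real"
  assumes surj: "surj \<pi>"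
    and finite_steps: "finite (set_pmf (K x))"
    and generator: "measure_pmf.expectation (K x) (\<lambda>z. f (\<pi> z)) = f (\<pi> x) + G f (\<pi> x) / L"
begin

definition step :: "('a \<Rightarrow> real) \<Rightarrow> 'a \<Rightarrow> real" where
  "step f a = f a + G f a / L"

lemma step_eq: "step f (\<pi> x) = measure_pmf.expectation (K x) (\<lambda>z. f (\<pi> z))"
  by (simp add: step_def generator)

lemma integrable_step: "integrable (measure_pmf (K x)) (f :: 's \<Rightarrow> real)"
  by (rule integrable_measure_pmf_finite[OF finite_steps])

lemma step_add: "step (\<lambda>x. f x + g x) a = step f a + step g a"
proof -
  obtain x where "a = \<pi> x" using surj by (rule surjE)
  then show ?thesis by (simp add: step_eq integrable_step)
qed

lemma step_scale: "step (\<lambda>x. c * f x) a = c * step f a"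
proof -
  obtain x where "a = \<pi> x" using surj by (rule surjE)
  then show ?thesis by (simp add: step_eq)
qed

lemma step_bounds:
  assumes "\<And>b. 0 \<le> f b \<and> f b \<le> 1"
  shows "0 \<le> step f a \<and> step f a \<le> 1"
proof -
  obtain x where a: "a = \<pi> x" using surj by (rule surjE)
  have "measure_pmf.expectation (K x) (\<lambda>z. f (\<pi> z)) \<le> measure_pmf.expectation (K x) (\<lambda>z. 1)"
    by (rule integral_mono) (use assms in \<open>auto intro: integrable_step\<close>)
  then show ?thesis using assms by (simp add: a step_eq)
qed

lemma step_power_bounds: "0 \<le> (step ^^ k) (indicator {y}) a \<and> (step ^^ k) (indicator {y}) a \<le> 1"
proof (induction k arbitrary: a)
  case (Suc k)
  then show ?case using step_bounds[of "(step ^^ k) (indicator {y})"] by simp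
qed (auto split: split_indicator)

text \<open>The jump count and the embedded chain are independent: holding times contribute
  \<open>pois k t\<close>, kicks contribute the power of \<open>step\<close>.\<close>

lemma emeasure_jumps_chain:
  "0 \<le> t \<Longrightarrow> emeasure driver {\<omega>. jumps k t \<omega> \<and> \<pi> (chain k x \<omega>) = y}
     = ennreal (pois k t * (step ^^ k) (indicator {y}) (\<pi> x))"
proof (induction k arbitrary: t x)
  case 0
  have "{\<omega>. jumps 0 t \<omega> \<and> \<pi> (chain 0 x \<omega>) = y} = (if \<pi> x = y then {\<omega>. jumps 0 t \<omega>} else {})"
    by auto
  then show ?case using emeasure_jumps[OF 0, of 0] by (auto split: split_indicator simp del: jumps.simps)
next
  case (Suc k)
  let ?q = "\<lambda>k x. (step ^^ k) (indicator {y}) (\<pi> x)"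
  have "emeasure driver {\<omega>. jumps (Suc k) t \<omega> \<and> \<pi> (chain (Suc k) x \<omega>) = y} =
    (\<integral>\<^sup>+s. \<integral>\<^sup>+z. emeasure driver {\<omega>. jumps (Suc k) t ((s, \<lambda>_. z) ## \<omega>) \<and>
        \<pi> (chain (Suc k) x ((s, \<lambda>_. z) ## \<omega>)) = y} \<partial>measure_pmf (K x) \<partial>holding)"
  proof (rule emeasure_first_step(1))
    have "Measurable.pred driver (\<lambda>\<omega>. jumps n t \<omega> \<and> \<pi> (chain n x \<omega>) = y)" for n
      by measurable
    then show "Measurable.pred driver (\<lambda>\<omega>. jumps (Suc k) t \<omega> \<and> \<pi> (chain (Suc k) x \<omega>) = y)" .
  qed simp
  also have "\<dots> = (\<integral>\<^sup>+s. (if s \<le> t then ennreal (pois k (t - s)) else 0) * ennreal (?q (Suc k) x) \<partial>holding)"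
  proof (rule nn_integral_cong)
    fix s
    have "(\<integral>\<^sup>+z. emeasure driver {\<omega>. jumps k (t - s) \<omega> \<and> \<pi> (chain k z \<omega>) = y} \<partial>measure_pmf (K x))
      = ennreal (pois k (t - s)) * ennreal (?q (Suc k) x)" if "s \<le> t"
    proof -
      have "(\<integral>\<^sup>+z. emeasure driver {\<omega>. jumps k (t - s) \<omega> \<and> \<pi> (chain k z \<omega>) = y} \<partial>measure_pmf (K x))
        = (\<integral>\<^sup>+z. ennreal (pois k (t - s)) * ennreal (?q k z) \<partial>measure_pmf (K x))"
        using that step_power_bounds pois_nonneg by (simp add: Suc.IH ennreal_mult)
      also have "\<dots> = ennreal (pois k (t - s)) * (\<integral>\<^sup>+z. ennreal (?q k z) \<partial>measure_pmf (K x))"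
        by (rule nn_integral_cmult) simp
      also have "(\<integral>\<^sup>+z. ennreal (?q k z) \<partial>measure_pmf (K x)) = ennreal (?q (Suc k) x)"
        using step_power_bounds
        by (subst nn_integral_eq_integral[OF integrable_step]) (auto simp: step_eq)
      finally show ?thesis .
    qed
    then show "(\<integral>\<^sup>+z. emeasure driver {\<omega>. jumps (Suc k) t ((s, \<lambda>_. z) ## \<omega>) \<and>
        \<pi> (chain (Suc k) x ((s, \<lambda>_. z) ## \<omega>)) = y} \<partial>measure_pmf (K x))
      = (if s \<le> t then ennreal (pois k (t - s)) else 0) * ennreal (?q (Suc k) x)"
      by simp
  qed
  also have "\<dots> = (\<integral>\<^sup>+s. (if s \<le> t then ennreal (pois k (t - s)) else 0) \<partial>holding) * ennreal (?q (Suc k) x)"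
  proof (rule nn_integral_multc)
    have [measurable]: "(\<lambda>s. pois k (t - s)) \<in> borel_measurable borel"
      unfolding pois_def by measurable
    show "(\<lambda>s. if s \<le> t then ennreal (pois k (t - s)) else 0) \<in> borel_measurable holding"
      by measurable
  qed
  also have "\<dots> = ennreal (pois (Suc k) t * ?q (Suc k) x)"
    using step_power_bounds[of "Suc k"] by (simp add: holding_pois[OF Suc.prems] ennreal_mult'' del: funpow.simps)
  finally show ?case .
qed

lemma semigroup_sums:
  "(\<lambda>k. pois k t * (step ^^ k) (indicator {y}) a) sums semigroup_of G t (indicator {y}) a"
  unfolding pois_def
proof (rule semigroup_of_uniformized)
  show "G f a = L * (step f a - f a)" for f a using L_pos by (simp add: step_def)
  show "\<bar>(step ^^ k) (indicator {y}) a\<bar> \<le> 1" for k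
    using step_power_bounds[of k y a] by simp
qed (rule step_add step_scale)+

lemma semigroup_nonneg: "0 \<le> t \<Longrightarrow> 0 \<le> semigroup_of G t (indicator {y}) a"
  using semigroup_sums[of t y a] pois_nonneg step_power_bounds
  by (metis (no_types, lifting) mult_nonneg_nonneg sums_le sums_zero)

lemma emeasure_process:
  assumes t: "0 \<le> t"
  shows "emeasure driver {\<omega>. \<pi> (process x t \<omega>) = y} = ennreal (semigroup_of G t (indicator {y}) (\<pi> x))"
proof -
  have "emeasure driver {\<omega>. \<pi> (process x t \<omega>) = y} =
      (\<Sum>k. emeasure driver {\<omega>. jumps k t \<omega> \<and> \<pi> (process x t \<omega>) = y})"
    by (rule emeasure_sum_jumps[OF _ t]) measurable
  also have "\<dots> = (\<Sum>k. ennreal (pois k t * (step ^^ k) (indicator {y}) (\<pi> x)))"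
  proof (rule suminf_cong)
    fix k
    have "{\<omega>. jumps k t \<omega> \<and> \<pi> (process x t \<omega>) = y} = {\<omega>. jumps k t \<omega> \<and> \<pi> (chain k x \<omega>) = y}"
      by (auto simp: process_eq)
    then show "emeasure driver {\<omega>. jumps k t \<omega> \<and> \<pi> (process x t \<omega>) = y}
        = ennreal (pois k t * (step ^^ k) (indicator {y}) (\<pi> x))"
      by (simp add: emeasure_jumps_chain t)
  qed
  also have "\<dots> = ennreal (semigroup_of G t (indicator {y}) (\<pi> x))"
    using semigroup_sums[of t y "\<pi> x"] pois_nonneg[OF t] step_power_bounds
    by (subst suminf_ennreal2) (auto simp: sums_iff)
  finally show ?thesis .
qed


lemma measurable_past [measurable]:
  "finite J \<Longrightarrow> Measurable.pred driver (\<lambda>\<omega>. \<forall>v\<in>J. \<pi> (process x v \<omega>) = z v)"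
  by (rule pred_intros_finite(3)) measurable

text \<open>Induction on the number of jumps up to \<open>t\<close>. Without a jump the past is
  constant and the exponential waiting time restarts at \<open>t\<close>; otherwise conditioning on
  the first jump leaves the same claim for a chain with one jump fewer, a new start, and shifted
  observation times.\<close>

lemma markov_jumps:
  assumes h: "0 \<le> h"
  shows "finite J \<Longrightarrow> J \<subseteq> {..t} \<Longrightarrow> 0 \<le> t \<Longrightarrow>
    emeasure driver {\<omega>. jumps k t \<omega> \<and> (\<forall>v\<in>J. \<pi> (process x v \<omega>) = z v) \<and>
      \<pi> (process x t \<omega>) = z t \<and> \<pi> (process x (t + h) \<omega>) = y} =
    emeasure driver {\<omega>. jumps k t \<omega> \<and> (\<forall>v\<in>J. \<pi> (process x v \<omega>) = z v) \<and> \<pi> (process x t \<omega>) = z t} *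
      ennreal (semigroup_of G h (indicator {y}) (z t))"
proof (induction k arbitrary: J t x z)
  case 0
  show ?case
  proof (cases "(\<forall>v\<in>J. \<pi> x = z v) \<and> \<pi> x = z t")
    case False
    have "jumps 0 t \<omega> \<Longrightarrow> v \<le> t \<Longrightarrow> process x v \<omega> = x" for v \<omega>
      using process_eq[of 0 v \<omega> x] by simp
    with False 0 have "\<not> (jumps 0 t \<omega> \<and> (\<forall>v\<in>J. \<pi> (process x v \<omega>) = z v) \<and> \<pi> (process x t \<omega>) = z t)" for \<omega>
      by (metis atMost_iff order_refl subset_eq)
    then have "{\<omega>. jumps 0 t \<omega> \<and> (\<forall>v\<in>J. \<pi> (process x v \<omega>) = z v) \<and> \<pi> (process x t \<omega>) = z t} = {}"
      "{\<omega>. jumps 0 t \<omega> \<and> (\<forall>v\<in>J. \<pi> (process x v \<omega>) = z v) \<and>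
        \<pi> (process x t \<omega>) = z t \<and> \<pi> (process x (t + h) \<omega>) = y} = {}"
      by blast+
    then show ?thesis by (simp only: emeasure_empty mult_zero_left)
  next
    case True
    have const: "jumps 0 t \<omega> \<Longrightarrow> v \<le> t \<Longrightarrow> process x v \<omega> = x" for v \<omega>
      using process_eq[of 0 v \<omega> x] by simp
    have "{\<omega>. jumps 0 t \<omega> \<and> (\<forall>v\<in>J. \<pi> (process x v \<omega>) = z v) \<and> \<pi> (process x t \<omega>) = z t} = {\<omega>. jumps 0 t \<omega>}"
      using const True 0 by (auto simp del: jumps.simps)
    then have past: "emeasure driver {\<omega>. jumps 0 t \<omega> \<and> (\<forall>v\<in>J. \<pi> (process x v \<omega>) = z v) \<and> \<pi> (process x t \<omega>) = z t}
        = ennreal (exp (- (L * t)))"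
      using emeasure_jumps[OF 0(3), of 0] by (simp only: pois_def) simp
    \<comment> \<open>\<open>g s\<close> is the probability of the event at time \<open>h\<close>
      given the first holding time \<open>s\<close>. If there is no jump by \<open>t\<close>, time
      \<open>t + h\<close> with first holding time \<open>s\<close> amounts to time \<open>h\<close>
      with first holding time \<open>s - t\<close>, so memorylessness applies to
      \<open>g\<close>.\<close>
    define g where "g s = (\<integral>\<^sup>+w. emeasure driver {\<omega>. \<pi> (process x h ((s, \<lambda>_. w) ## \<omega>)) = y} \<partial>measure_pmf (K x))" for s
    have m: "Measurable.pred driver (\<lambda>\<omega>. \<pi> (process x h \<omega>) = y)" by measurable
    have g: "g \<in> borel_measurable borel" "(\<integral>\<^sup>+s. g s \<partial>holding) = ennreal (semigroup_of G h (indicator {y}) (\<pi> x))"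
      unfolding g_def
      using emeasure_first_step[OF m, of x] emeasure_process[OF h, of x y]
      by (simp_all add: process_Stream)
    have "{\<omega>. jumps 0 t \<omega> \<and> (\<forall>v\<in>J. \<pi> (process x v \<omega>) = z v) \<and>
        \<pi> (process x t \<omega>) = z t \<and> \<pi> (process x (t + h) \<omega>) = y}
      = {\<omega>. jumps 0 t \<omega> \<and> \<pi> (process x (t + h) \<omega>) = y}"
      using const True 0 by (auto simp del: jumps.simps)
    also have "emeasure driver \<dots> = (\<integral>\<^sup>+s. \<integral>\<^sup>+w. emeasure driver {\<omega>. jumps 0 t ((s, \<lambda>_. w) ## \<omega>) \<and>
        \<pi> (process x (t + h) ((s, \<lambda>_. w) ## \<omega>)) = y} \<partial>measure_pmf (K x) \<partial>holding)"
    proof (rule emeasure_first_step(1))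
      have "Measurable.pred driver (\<lambda>\<omega>. jumps n t \<omega> \<and> \<pi> (process x (t + h) \<omega>) = y)" for n by measurable
      then show "Measurable.pred driver (\<lambda>\<omega>. jumps 0 t \<omega> \<and> \<pi> (process x (t + h) \<omega>) = y)" .
    qed (simp add: process_Stream)
    also have "\<dots> = (\<integral>\<^sup>+s. (if t < s then g (s - t) else 0) \<partial>holding)"
    proof (rule nn_integral_cong)
      fix s
      have "process x (t + h) ((s, u) ## \<omega>) = process x h ((s - t, u) ## \<omega>)" for u \<omega>
        by (auto simp: process_Stream algebra_simps)
      then show "(\<integral>\<^sup>+w. emeasure driver {\<omega>. jumps 0 t ((s, \<lambda>_. w) ## \<omega>) \<and>
          \<pi> (process x (t + h) ((s, \<lambda>_. w) ## \<omega>)) = y} \<partial>measure_pmf (K x))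
        = (if t < s then g (s - t) else 0)"
        by (simp add: g_def)
    qed
    also have "\<dots> = ennreal (exp (- (L * t))) * ennreal (semigroup_of G h (indicator {y}) (\<pi> x))"
      by (simp add: holding_memoryless[OF g(1) 0(3)] g(2))
    finally show ?thesis using True by (simp only: past)
  qed
next
  case (Suc k)
  let ?P = "\<lambda>n \<omega>. jumps n t \<omega> \<and> (\<forall>v\<in>J. \<pi> (process x v \<omega>) = z v) \<and> \<pi> (process x t \<omega>) = z t"
  let ?Q = "\<lambda>n \<omega>. jumps n t \<omega> \<and> (\<forall>v\<in>J. \<pi> (process x v \<omega>) = z v) \<and>
    \<pi> (process x t \<omega>) = z t \<and> \<pi> (process x (t + h) \<omega>) = y"
  let ?q = "ennreal (semigroup_of G h (indicator {y}) (z t))"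
  note Suc.prems(1) [measurable]
  have mP: "Measurable.pred driver (?P n)" and mQ: "Measurable.pred driver (?Q n)" for n
    by measurable
  have eq: "emeasure driver {\<omega>. ?Q (Suc k) ((s, \<lambda>_. w) ## \<omega>)} = emeasure driver {\<omega>. ?P (Suc k) ((s, \<lambda>_. w) ## \<omega>)} * ?q" for s w
  proof (cases "s \<le> t \<and> (\<forall>v\<in>J. v < s \<longrightarrow> \<pi> x = z v)")
    case True
    \<comment> \<open>Observation times before the first jump see the start \<open>x\<close> and are
      settled by the case assumption; the others are shifted by \<open>s\<close> and observe the
      chain restarted in \<open>w\<close>.\<close>
    define J' where "J' = (\<lambda>v. v - s) ` {v\<in>J. s \<le> v}"
    have J': "finite J'" "J' \<subseteq> {..t - s}" "0 \<le> t - s"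
      using Suc.prems True by (auto simp: J'_def)
    have past: "(\<forall>v\<in>J. \<pi> (process x v ((s, \<lambda>_. w) ## \<omega>)) = z v) \<longleftrightarrow>
        (\<forall>v\<in>J'. \<pi> (process w v \<omega>) = z (v + s))" for \<omega>
      using True by (auto simp: J'_def process_Stream)
    have th: "t + h - s = t - s + h" by simp
    have "{\<omega>. ?Q (Suc k) ((s, \<lambda>_. w) ## \<omega>)} = {\<omega>. jumps k (t - s) \<omega> \<and> (\<forall>v\<in>J'. \<pi> (process w v \<omega>) = z (v + s)) \<and>
        \<pi> (process w (t - s) \<omega>) = z (t - s + s) \<and> \<pi> (process w (t - s + h) \<omega>) = y}"
      unfolding past using True h by (simp add: process_Stream th)
    moreover have "{\<omega>. ?P (Suc k) ((s, \<lambda>_. w) ## \<omega>)} = {\<omega>. jumps k (t - s) \<omega> \<and> (\<forall>v\<in>J'. \<pi> (process w v \<omega>) = z (v + s)) \<and>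
        \<pi> (process w (t - s) \<omega>) = z (t - s + s)}"
      unfolding past using True h by (simp add: process_Stream)
    ultimately show ?thesis
      using Suc.IH[OF J', of w "\<lambda>v. z (v + s)"] by simp
  next
    case False
    then have "{\<omega>. ?Q (Suc k) ((s, \<lambda>_. w) ## \<omega>)} = {}" "{\<omega>. ?P (Suc k) ((s, \<lambda>_. w) ## \<omega>)} = {}"
      by (auto simp: process_Stream)
    then show ?thesis by (simp only: emeasure_empty mult_zero_left)
  qed
  have "emeasure driver {\<omega>. ?Q (Suc k) \<omega>} =
      (\<integral>\<^sup>+s. \<integral>\<^sup>+w. emeasure driver {\<omega>. ?Q (Suc k) ((s, \<lambda>_. w) ## \<omega>)} \<partial>measure_pmf (K x) \<partial>holding)"
    by (rule emeasure_first_step(1)[OF mQ]) (simp add: process_Stream)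
  also have "\<dots> = (\<integral>\<^sup>+s. (\<integral>\<^sup>+w. emeasure driver {\<omega>. ?P (Suc k) ((s, \<lambda>_. w) ## \<omega>)} \<partial>measure_pmf (K x)) * ?q \<partial>holding)"
    unfolding eq by (intro nn_integral_cong nn_integral_multc) simp
  also have "\<dots> = (\<integral>\<^sup>+s. \<integral>\<^sup>+w. emeasure driver {\<omega>. ?P (Suc k) ((s, \<lambda>_. w) ## \<omega>)} \<partial>measure_pmf (K x) \<partial>holding) * ?q"
  proof (rule nn_integral_multc)
    show "(\<lambda>s. \<integral>\<^sup>+w. emeasure driver {\<omega>. ?P (Suc k) ((s, \<lambda>_. w) ## \<omega>)} \<partial>measure_pmf (K x)) \<in> borel_measurable holding"
      using emeasure_first_step(2)[OF mP[of "Suc k"], of x] by (simp add: process_Stream cong: measurable_cong_sets)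
  qed
  also have "(\<integral>\<^sup>+s. \<integral>\<^sup>+w. emeasure driver {\<omega>. ?P (Suc k) ((s, \<lambda>_. w) ## \<omega>)} \<partial>measure_pmf (K x) \<partial>holding)
      = emeasure driver {\<omega>. ?P (Suc k) \<omega>}"
    by (rule emeasure_first_step(1)[OF mP, symmetric]) (simp add: process_Stream)
  finally show ?case .
qed

lemma emeasure_markov:
  assumes "finite J" "J \<subseteq> {..t}" "0 \<le> t" "0 \<le> h"
  shows "emeasure driver {\<omega>. (\<forall>v\<in>J. \<pi> (process x v \<omega>) = z v) \<and>
      \<pi> (process x t \<omega>) = z t \<and> \<pi> (process x (t + h) \<omega>) = y} =
    emeasure driver {\<omega>. (\<forall>v\<in>J. \<pi> (process x v \<omega>) = z v) \<and> \<pi> (process x t \<omega>) = z t} *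
      ennreal (semigroup_of G h (indicator {y}) (z t))"
proof -
  note assms(1) [measurable]
  have "emeasure driver {\<omega>. (\<forall>v\<in>J. \<pi> (process x v \<omega>) = z v) \<and>
      \<pi> (process x t \<omega>) = z t \<and> \<pi> (process x (t + h) \<omega>) = y}
    = (\<Sum>k. emeasure driver {\<omega>. jumps k t \<omega> \<and> (\<forall>v\<in>J. \<pi> (process x v \<omega>) = z v) \<and>
      \<pi> (process x t \<omega>) = z t \<and> \<pi> (process x (t + h) \<omega>) = y})"
    by (rule emeasure_sum_jumps[OF _ assms(3)]) measurable
  also have "\<dots> = (\<Sum>k. emeasure driver {\<omega>. jumps k t \<omega> \<and> (\<forall>v\<in>J. \<pi> (process x v \<omega>) = z v) \<and>
      \<pi> (process x t \<omega>) = z t}) * ennreal (semigroup_of G h (indicator {y}) (z t))"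
    by (simp only: markov_jumps[OF assms(4,1-3)] ennreal_suminf_multc)
  also have "(\<Sum>k. emeasure driver {\<omega>. jumps k t \<omega> \<and> (\<forall>v\<in>J. \<pi> (process x v \<omega>) = z v) \<and>
      \<pi> (process x t \<omega>) = z t}) = emeasure driver {\<omega>. (\<forall>v\<in>J. \<pi> (process x v \<omega>) = z v) \<and> \<pi> (process x t \<omega>) = z t}"
    by (rule emeasure_sum_jumps[OF _ assms(3), symmetric]) measurable
  finally show ?thesis .
qed

lemma process_0: "AE \<omega> in driver. process x 0 \<omega> = x"
proof -
  interpret prob_space driver by (rule prob_space_driver)
  have "emeasure driver {\<omega>\<in>space driver. jumps 0 0 \<omega>} = 1"
    using emeasure_jumps[of 0 0] by (simp add: pois_def del: jumps.simps)
  then have "AE \<omega> in driver. jumps 0 0 \<omega>"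
    by (rule AE_I_eq_1) (use measurable_jumps[of 0 0] in \<open>simp add: pred_def\<close>)
  then show ?thesis by eventually_elim (simp add: process_eq[of 0])
qed

theorem markov_jump_process_process:
  "markov_jump_process G (\<pi> x) driver (\<lambda>t \<omega>. \<pi> (process x t \<omega>))"
  unfolding markov_jump_process_def
proof (intro conjI allI impI)
  show "right_continuous_paths driver (\<lambda>t \<omega>. \<pi> (process x t \<omega>))"
    unfolding right_continuous_paths_def
    using AE_process_right_continuous[of x]
    by (rule eventually_mono) (intro allI impI, erule allE, erule eventually_mono, simp)
  show "AE \<omega> in driver. \<pi> (process x 0 \<omega>) = \<pi> x"
    using process_0[of x] by eventually_elim simp
  fix s t :: real and J and z :: "real \<Rightarrow> 'a" and y
  assume st: "0 \<le> s" "0 \<le> t" and J: "finite J \<and> J \<subseteq> {0..s}"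
  have J': "finite J" "J \<subseteq> {..s}" using J by auto
  show "measure driver {\<omega> \<in> space driver. (\<forall>u\<in>J. \<pi> (process x u \<omega>) = z u) \<and>
      \<pi> (process x s \<omega>) = z s \<and> \<pi> (process x (s + t) \<omega>) = y} =
    measure driver {\<omega> \<in> space driver. (\<forall>u\<in>J. \<pi> (process x u \<omega>) = z u) \<and> \<pi> (process x s \<omega>) = z s} *
      semigroup_of G t (indicator {y}) (z s)"
    using emeasure_markov[OF J' st, of x z y] semigroup_nonneg[OF st(2), of y "z s"]
    by (simp add: measure_def enn2real_mult)
qed (use prob_space_driver in \<open>simp_all\<close>)

end

subsection \<open>Laws and couplings\<close>

text \<open>Times are added in increasing order. The Markov property at \<open>Max J\<close>
  multiplies by one transition probability, which \<open>A\<close> determines; the first time is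
  reached from time 0, where the state is almost surely \<open>x0\<close>.\<close>

lemma finite_dimensional_distributions_unique:
  fixes X :: "real \<Rightarrow> 'v \<Rightarrow> 's::countable" and Y :: "real \<Rightarrow> 'w \<Rightarrow> 's"
  assumes X: "markov_jump_process A x0 M X" and Y: "markov_jump_process A x0 N Y"
    and "finite J" "J \<subseteq> {0..}"
  shows "measure M {\<omega>\<in>space M. \<forall>u\<in>J. X u \<omega> = z u} = measure N {\<omega>\<in>space N. \<forall>u\<in>J. Y u \<omega> = z u}"
proof -
  have initial: "measure M {\<omega>\<in>space M. X t \<omega> = y} = semigroup_of A t (indicator {y}) x0"
    if "markov_jump_process A x0 M X" "0 \<le> t" for M :: "'u measure" and X t y
  proof -
    interpret prob_space M using that(1) by (simp add: markov_jump_process_def)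
    have [measurable]: "\<And>t. 0 \<le> t \<Longrightarrow> X t \<in> measurable M (count_space UNIV)"
      using that(1) by (simp add: markov_jump_process_def)
    note [measurable] = this[OF that(2)] this[of 0, simplified]
    have ae: "AE \<omega> in M. X 0 \<omega> = x0"
      using that(1) by (simp add: markov_jump_process_def)
    have "measure M {\<omega>\<in>space M. X t \<omega> = y} = measure M {\<omega>\<in>space M. X 0 \<omega> = x0 \<and> X t \<omega> = y}"
      by (rule finite_measure_eq_AE) (use ae in auto)
    also have "\<dots> = measure M {\<omega>\<in>space M. X 0 \<omega> = x0} * semigroup_of A t (indicator {y}) x0"
    proof -
      have mk: "\<forall>s\<ge>0. \<forall>t\<ge>0. \<forall>J z y. finite J \<and> J \<subseteq> {0..s} \<longrightarrow>
        measure M {\<omega> \<in> space M. (\<forall>u\<in>J. X u \<omega> = z u) \<and> X s \<omega> = z s \<and> X (s + t) \<omega> = y} =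
        measure M {\<omega> \<in> space M. (\<forall>u\<in>J. X u \<omega> = z u) \<and> X s \<omega> = z s} *
          semigroup_of A t (indicator {y}) (z s)"
        using that(1) by (simp add: markov_jump_process_def)
      show ?thesis
        using mk[rule_format, of 0 t "{}" "\<lambda>_. x0" y] that(2) by simp
    qed
    also have "measure M {\<omega>\<in>space M. X 0 \<omega> = x0} = 1"
      using ae by (subst prob_Collect_eq_1) auto
    finally show ?thesis by simp
  qed
  have ext: "measure M {\<omega>\<in>space M. \<forall>u\<in>insert b J. X u \<omega> = z u} =
      measure M {\<omega>\<in>space M. \<forall>u\<in>J. X u \<omega> = z u} * semigroup_of A (b - Max J) (indicator {z b}) (z (Max J))"
    if mp: "markov_jump_process A x0 M X" and J: "finite J" "J \<noteq> {}" "\<forall>u\<in>J. u < b" "J \<subseteq> {0..}"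
    for M :: "'u measure" and X J b
  proof -
    have mk: "\<forall>s\<ge>0. \<forall>t\<ge>0. \<forall>J z y. finite J \<and> J \<subseteq> {0..s} \<longrightarrow>
        measure M {\<omega> \<in> space M. (\<forall>u\<in>J. X u \<omega> = z u) \<and> X s \<omega> = z s \<and> X (s + t) \<omega> = y} =
        measure M {\<omega> \<in> space M. (\<forall>u\<in>J. X u \<omega> = z u) \<and> X s \<omega> = z s} *
          semigroup_of A t (indicator {y}) (z s)"
      using mp by (simp add: markov_jump_process_def)
    have m: "Max J \<in> J" using J by simp
    have "Max J \<in> {0..}" "Max J < b" using m J(3,4) by blast+
    moreover have "finite J \<and> J \<subseteq> {0..Max J}"
      using J(1,4) by auto
    ultimately have "measure M {\<omega> \<in> space M. (\<forall>u\<in>J. X u \<omega> = z u) \<and> X (Max J) \<omega> = z (Max J) \<and> X (Max J + (b - Max J)) \<omega> = z b} =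
        measure M {\<omega> \<in> space M. (\<forall>u\<in>J. X u \<omega> = z u) \<and> X (Max J) \<omega> = z (Max J)} *
          semigroup_of A (b - Max J) (indicator {z b}) (z (Max J))"
      by (intro mk[rule_format]) auto
    moreover have "{\<omega> \<in> space M. (\<forall>u\<in>J. X u \<omega> = z u) \<and> X (Max J) \<omega> = z (Max J) \<and> X (Max J + (b - Max J)) \<omega> = z b}
      = {\<omega>\<in>space M. \<forall>u\<in>insert b J. X u \<omega> = z u}"
      using m by auto
    moreover have "{\<omega> \<in> space M. (\<forall>u\<in>J. X u \<omega> = z u) \<and> X (Max J) \<omega> = z (Max J)}
      = {\<omega>\<in>space M. \<forall>u\<in>J. X u \<omega> = z u}"
      using m by auto
    ultimately show ?thesis by simp
  qed
  show ?thesis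
    using assms(3,4)
  proof (induction J rule: finite_linorder_max_induct)
    case empty
    show ?case
      using X Y by (simp add: markov_jump_process_def prob_space.prob_space)
  next
    case (insert b J)
    show ?case
    proof (cases "J = {}")
      case True
      with insert.prems initial[OF X] initial[OF Y] show ?thesis by simp
    next
      case False
      have J: "J \<subseteq> {0..}" using insert.prems by simp
      show ?thesis
        unfolding ext[OF X insert.hyps(1) False insert.hyps(2) J] ext[OF Y insert.hyps(1) False insert.hyps(2) J]
          insert.IH[OF J] ..
    qed
  qed
qed

text \<open>The family is a function of the state path, so it suffices to compare path laws. These
  are determined by cylinders, and countability of the state space reduces each finite-dimensional
  law to its point masses.\<close>

lemma process_law_cong_distributions:
  fixes X :: "real \<Rightarrow> 'v \<Rightarrow> 's::countable" and Y :: "real \<Rightarrow> 'w \<Rightarrow> 's" and F :: "nat \<Rightarrow> 's \<Rightarrow> nat"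
  assumes M: "prob_space M" and N: "prob_space N"
    and X: "\<And>t. 0 \<le> t \<Longrightarrow> X t \<in> measurable M (count_space UNIV)"
    and Y: "\<And>t. 0 \<le> t \<Longrightarrow> Y t \<in> measurable N (count_space UNIV)"
    and fdd: "\<And>J z. finite J \<Longrightarrow> J \<subseteq> {0..} \<Longrightarrow>
      measure M {\<omega>\<in>space M. \<forall>u\<in>J. X u \<omega> = z u} = measure N {\<omega>\<in>space N. \<forall>u\<in>J. Y u \<omega> = z u}"
  shows "process_law M (\<lambda>m t \<omega>. F m (X t \<omega>)) = process_law N (\<lambda>m t \<omega>. F m (Y t \<omega>))"
proof -
  let ?I = "{0::real..}"
  let ?S = "Pi\<^sub>M ?I (\<lambda>_. count_space (UNIV :: 's set))"
  have path [measurable]: "(\<lambda>\<omega>. \<lambda>t\<in>?I. Z t \<omega>) \<in> measurable Q ?S"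
    if "\<And>t. 0 \<le> t \<Longrightarrow> Z t \<in> measurable Q (count_space UNIV)" for Q :: "'u measure" and Z
    using that by (intro measurable_restrict) auto
  have law: "process_law Q (\<lambda>m t \<omega>. F m (Z t \<omega>)) =
      distr (distr Q ?S (\<lambda>\<omega>. \<lambda>t\<in>?I. Z t \<omega>)) (Pi\<^sub>M ({1..} \<times> {0..}) (\<lambda>_. count_space UNIV))
        (\<lambda>p. \<lambda>(m, t)\<in>{1..} \<times> {0..}. F m (p t))"
    if Z: "\<And>t. 0 \<le> t \<Longrightarrow> Z t \<in> measurable Q (count_space UNIV)" for Q :: "'u measure" and Z
  proof -
    have eval: "(\<lambda>p. \<lambda>(m, t)\<in>{1..} \<times> {0..}. F m (p t)) \<in> measurable ?S (Pi\<^sub>M ({1..} \<times> {0..}) (\<lambda>_. count_space UNIV))"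
    proof (rule measurable_restrict)
      fix i :: "nat \<times> real" assume "i \<in> {1..} \<times> {0..}"
      then have "(\<lambda>p. p (snd i)) \<in> measurable ?S (count_space UNIV)"
        by (intro measurable_component_singleton) auto
      from measurable_compose[OF this, of "F (fst i)"]
      show "(\<lambda>p. case i of (m, t) \<Rightarrow> F m (p t)) \<in> measurable ?S (count_space UNIV)"
        by (simp add: case_prod_beta)
    qed
    show ?thesis
      unfolding process_law_def
      by (subst distr_distr[OF eval path[OF Z]]) (auto intro!: arg_cong[where f="distr Q _"] simp: fun_eq_iff restrict_def)
  qed
  have marginal: "emeasure (distr Q ?S (\<lambda>\<omega>. \<lambda>t\<in>?I. Z t \<omega>)) (prod_emb ?I (\<lambda>_. count_space UNIV) J (Pi\<^sub>E J B))
      = emeasure (distr Q (count_space (PiE J (\<lambda>_. UNIV))) (\<lambda>\<omega>. \<lambda>t\<in>J. Z t \<omega>)) (PiE J B)"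
    and finite_path: "(\<lambda>\<omega>. \<lambda>t\<in>J. Z t \<omega>) \<in> measurable Q (count_space (PiE J (\<lambda>_. UNIV)))"
    if J: "finite J" "J \<subseteq> ?I" and Z: "\<And>t. 0 \<le> t \<Longrightarrow> Z t \<in> measurable Q (count_space UNIV)"
    for Q :: "'u measure" and Z J B
  proof -
    have "(\<lambda>\<omega>. \<lambda>t\<in>J. Z t \<omega>) \<in> measurable Q (Pi\<^sub>M J (\<lambda>_. count_space UNIV))"
      using J Z by (intro measurable_restrict) auto
    then show m: "(\<lambda>\<omega>. \<lambda>t\<in>J. Z t \<omega>) \<in> measurable Q (count_space (PiE J (\<lambda>_. UNIV)))"
      using J by (simp add: count_space_PiM_finite)
    have cyl: "prod_emb ?I (\<lambda>_. count_space UNIV) J (Pi\<^sub>E J B) \<in> sets ?S"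
      using J by (intro sets_PiM_I) auto
    show "emeasure (distr Q ?S (\<lambda>\<omega>. \<lambda>t\<in>?I. Z t \<omega>)) (prod_emb ?I (\<lambda>_. count_space UNIV) J (Pi\<^sub>E J B))
      = emeasure (distr Q (count_space (PiE J (\<lambda>_. UNIV))) (\<lambda>\<omega>. \<lambda>t\<in>J. Z t \<omega>)) (PiE J B)"
    proof -
      have "0 \<le> i" if "i \<in> J" for i using J that by auto
      then have "(\<lambda>\<omega>. \<lambda>t\<in>?I. Z t \<omega>) -` prod_emb ?I (\<lambda>_. count_space UNIV) J (Pi\<^sub>E J B) \<inter> space Q
          = (\<lambda>\<omega>. \<lambda>t\<in>J. Z t \<omega>) -` PiE J B \<inter> space Q"
        by (auto simp: prod_emb_def PiE_iff extensional_def)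
      then show ?thesis
        using emeasure_distr[OF path[OF Z] cyl] emeasure_distr[OF m, of "PiE J B"]
        by (simp add: PiE_mono)
    qed
  qed
  have "distr M ?S (\<lambda>\<omega>. \<lambda>t\<in>?I. X t \<omega>) = distr N ?S (\<lambda>\<omega>. \<lambda>t\<in>?I. Y t \<omega>)"
  proof (rule measure_eqI_PiM_infinite)
    fix B J assume J: "finite J" "J \<subseteq> ?I"
    have "distr M (count_space (PiE J (\<lambda>_. UNIV))) (\<lambda>\<omega>. \<lambda>t\<in>J. X t \<omega>)
      = distr N (count_space (PiE J (\<lambda>_. UNIV))) (\<lambda>\<omega>. \<lambda>t\<in>J. Y t \<omega>)"
    proof (rule measure_eqI_countable[where A="PiE J (\<lambda>_. UNIV)"])
      show "countable (PiE J (\<lambda>_. UNIV :: 's set))" using J by (intro countable_PiE) auto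
      fix z :: "real \<Rightarrow> 's" assume z: "z \<in> PiE J (\<lambda>_. UNIV)"
      have singleton: "(\<lambda>\<omega>. \<lambda>t\<in>J. Z t \<omega>) -` {z} \<inter> space Q = {\<omega>\<in>space Q. \<forall>u\<in>J. Z u \<omega> = z u}"
        for Q :: "'u measure" and Z
        using z by (auto simp: fun_eq_iff PiE_iff extensional_def restrict_def)
      have "emeasure M {\<omega>\<in>space M. \<forall>u\<in>J. X u \<omega> = z u} = emeasure N {\<omega>\<in>space N. \<forall>u\<in>J. Y u \<omega> = z u}"
        using fdd[OF J, of z] M N by (simp add: finite_measure.emeasure_eq_measure prob_space_def)
      then show "emeasure (distr M (count_space (PiE J (\<lambda>_. UNIV))) (\<lambda>\<omega>. \<lambda>t\<in>J. X t \<omega>)) {z} =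
          emeasure (distr N (count_space (PiE J (\<lambda>_. UNIV))) (\<lambda>\<omega>. \<lambda>t\<in>J. Y t \<omega>)) {z}"
        using z by (simp add: emeasure_distr finite_path J X Y singleton)
    qed auto
    then show "emeasure (distr M ?S (\<lambda>\<omega>. \<lambda>t\<in>?I. X t \<omega>)) (prod_emb ?I (\<lambda>_. count_space UNIV) J (Pi\<^sub>E J B)) =
        emeasure (distr N ?S (\<lambda>\<omega>. \<lambda>t\<in>?I. Y t \<omega>)) (prod_emb ?I (\<lambda>_. count_space UNIV) J (Pi\<^sub>E J B))"
      by (simp add: marginal J X Y)
  next
    show "finite_measure (distr M ?S (\<lambda>\<omega>. \<lambda>t\<in>?I. X t \<omega>))"
      by (intro prob_space.finite_measure prob_space.prob_space_distr M path X)
  qed auto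
  then show ?thesis by (simp only: law[OF X] law[OF Y])
qed

text \<open>Order or right-continuity at all times involves uncountably many conditions and need not
  define an event of \<open>S\<close>. Over the completion, every almost sure property has a
  measurable preimage and hence is a measurable set of \<open>Q\<close>, as the transfer to the
  image measure requires. Completion does not change laws.\<close>

lemma process_st_leI:
  fixes S :: "'v measure" and X' Y' :: "nat \<Rightarrow> real \<Rightarrow> 'v \<Rightarrow> nat"
  assumes S: "prob_space S" and X: "copy_of_process S X' M1 X" and Y: "copy_of_process S Y' M2 Y"
    and le: "AE \<omega> in S. \<forall>m\<ge>1. \<forall>t\<ge>0. X' m t \<omega> \<le> Y' m t \<omega>"
  shows "process_st_le M1 X M2 Y"
proof -
  define C where "C = completion S"
  define \<Phi> :: "'v \<Rightarrow> (nat \<Rightarrow> real \<Rightarrow> nat) \<times> (nat \<Rightarrow> real \<Rightarrow> nat)"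
    where "\<Phi> \<omega> = ((\<lambda>m t. X' m t \<omega>), (\<lambda>m t. Y' m t \<omega>))" for \<omega>
  define \<B> where "\<B> = {B. \<Phi> -` B \<inter> space C \<in> sets C}"
  define Q where "Q = sigma UNIV \<B>"
  have "sigma_algebra UNIV \<B>"
  proof (rule sigma_algebra_iff2[THEN iffD2], safe)
    show "{} \<in> \<B>" by (simp add: \<B>_def)
  next
    fix B assume "B \<in> \<B>"
    then have "space C - (\<Phi> -` B \<inter> space C) \<in> sets C" by (auto simp: \<B>_def)
    also have "space C - (\<Phi> -` B \<inter> space C) = \<Phi> -` (UNIV - B) \<inter> space C" by auto
    finally show "UNIV - B \<in> \<B>" by (simp add: \<B>_def)
  next
    fix B :: "nat \<Rightarrow> _" assume "range B \<subseteq> \<B>"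
    then have "(\<Union>i. \<Phi> -` B i \<inter> space C) \<in> sets C" by (intro sets.countable_UN) (auto simp: \<B>_def)
    also have "(\<Union>i. \<Phi> -` B i \<inter> space C) = \<Phi> -` (\<Union>i. B i) \<inter> space C" by auto
    finally show "(\<Union>i. B i) \<in> \<B>" by (simp add: \<B>_def)
  qed auto
  then have sets_Q: "sets Q = \<B>" and space_Q: "space Q = UNIV"
    by (simp_all add: Q_def sigma_algebra.sigma_sets_eq)
  have \<Phi>: "\<Phi> \<in> measurable C Q"
    by (rule measurableI) (auto simp: sets_Q space_Q \<B>_def)
  interpret S: prob_space S by (rule S)
  have C: "prob_space C"
    unfolding C_def by (rule prob_spaceI) (simp add: S.emeasure_space_1)
  let ?M = "distr C Q \<Phi>"
  have AE_transfer: "AE p in ?M. P p" if "AE \<omega> in S. P (\<Phi> \<omega>)" for P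
  proof -
    have "AE \<omega> in C. P (\<Phi> \<omega>)" using that unfolding C_def by (rule AE_completion)
    moreover have "{p\<in>space Q. P p} \<in> sets Q"
    proof -
      have "{\<omega>\<in>space C. \<not> P (\<Phi> \<omega>)} \<in> null_sets C"
        using that unfolding C_def by (auto simp: null_sets_completion_iff2 eventually_ae_filter)
      then have "space C - {\<omega>\<in>space C. \<not> P (\<Phi> \<omega>)} \<in> sets C" by auto
      also have "space C - {\<omega>\<in>space C. \<not> P (\<Phi> \<omega>)} = \<Phi> -` {p. P p} \<inter> space C" by auto
      finally show ?thesis by (simp add: sets_Q space_Q \<B>_def)
    qed
    ultimately show ?thesis using \<Phi> by (subst AE_distr_iff)
  qed
  have copy: "copy_of_process ?M (\<lambda>m t p. g p m t) N Z"
    if Z': "copy_of_process S Z' N Z" and g: "\<And>m t \<omega>. g (\<Phi> \<omega>) m t = Z' m t \<omega>"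
    for g Z' and N :: "'u measure" and Z
    unfolding copy_of_process_def
  proof (intro conjI allI impI)
    have g': "g (\<Phi> \<omega>) = (\<lambda>m t. Z' m t \<omega>)" for \<omega> by (simp add: fun_eq_iff g)
    have Z'_meas: "Z' m t \<in> measurable S (count_space UNIV)" if "1 \<le> m" "0 \<le> t" for m t
      using Z' that by (simp add: copy_of_process_def)
    have coord: "(\<lambda>p. g p m t) \<in> measurable Q (count_space UNIV)" if mt: "1 \<le> m" "0 \<le> t" for m t
    proof (rule measurableI)
      fix B :: "nat set"
      have "Z' m t \<in> measurable C (count_space UNIV)"
        unfolding C_def by (rule measurable_completion[OF Z'_meas[OF mt]])
      then have "Z' m t -` B \<inter> space C \<in> sets C" by (rule measurable_sets) simp
      also have "Z' m t -` B \<inter> space C = \<Phi> -` ((\<lambda>p. g p m t) -` B \<inter> space Q) \<inter> space C"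
        by (simp add: vimage_def g space_Q)
      finally show "(\<lambda>p. g p m t) -` B \<inter> space Q \<in> sets Q" by (simp add: sets_Q \<B>_def)
    qed simp
    show "(\<lambda>p. g p m t) \<in> measurable ?M (count_space UNIV)" if "1 \<le> m" "0 \<le> t" for m t
      using coord[OF that] by simp
    show "right_continuous_paths ?M (\<lambda>t p. g p m t)" if "1 \<le> m" for m
      unfolding right_continuous_paths_def
      using Z' that by (intro AE_transfer) (simp add: g copy_of_process_def right_continuous_paths_def)
    let ?P = "Pi\<^sub>M ({1::nat..} \<times> {0::real..}) (\<lambda>_. count_space (UNIV :: nat set))"
    have path_Q: "(\<lambda>p. \<lambda>(m, t)\<in>{1..} \<times> {0..}. g p m t) \<in> measurable Q ?P"
      using coord by (intro measurable_restrict) auto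
    have path_S: "(\<lambda>\<omega>. \<lambda>(m, t)\<in>{1..} \<times> {0..}. Z' m t \<omega>) \<in> measurable S ?P"
      using Z'_meas by (intro measurable_restrict) auto
    have "process_law ?M (\<lambda>m t p. g p m t) = distr C ?P (\<lambda>\<omega>. \<lambda>(m, t)\<in>{1..} \<times> {0..}. Z' m t \<omega>)"
      unfolding process_law_def by (subst distr_distr[OF path_Q \<Phi>]) (simp add: comp_def g')
    also have "\<dots> = process_law S Z'"
      unfolding process_law_def C_def by (rule distr_completion[OF path_S])
    also have "\<dots> = process_law N Z" using Z' by (simp add: copy_of_process_def)
    finally show "process_law ?M (\<lambda>m t p. g p m t) = process_law N Z" .
  qed
  show ?thesis
    unfolding process_st_le_def
  proof (intro exI conjI)
    show "prob_space ?M" by (rule prob_space.prob_space_distr[OF C \<Phi>])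
    show "copy_of_process ?M (\<lambda>m t p. fst p m t) M1 X" by (rule copy[OF X]) (simp add: \<Phi>_def)
    show "copy_of_process ?M (\<lambda>m t p. snd p m t) M2 Y" by (rule copy[OF Y]) (simp add: \<Phi>_def)
    show "AE p in ?M. \<forall>m\<ge>1. \<forall>t\<ge>0. fst p m t \<le> snd p m t"
      by (rule AE_transfer) (use le in \<open>simp add: \<Phi>_def\<close>)
  qed
qed

subsection \<open>Tail sums and rank matchings\<close>

text \<open>Double counting: server \<open>n\<close> is counted once for each level from
  \<open>m\<close> to \<open>q n\<close>. Above the longest queue all counts vanish, so the infinite
  sum is finite.\<close>

lemma Qbar_plus_eq: "Qbar_plus q m = (\<Sum>n\<in>UNIV. Suc (q n) - m)"
proof -
  define M where "M = Max (range q)"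
  have le: "q n \<le> M" for n by (simp add: M_def)
  have count: "Qbar q i = (\<Sum>n\<in>UNIV. of_bool (i \<le> q n))" for i
    by (simp add: Qbar_def)
  have "Qbar_plus q m = (\<Sum>\<^sub>\<infinity>i\<in>{m..M}. Qbar q i)"
    unfolding Qbar_plus_def
  proof (rule infsum_cong_neutral)
    fix i assume "i \<in> {m..} - {m..M}"
    then have "\<not> i \<le> q n" for n using le[of n] by auto
    then show "Qbar q i = 0" by (simp add: Qbar_def)
  qed auto
  also have "\<dots> = (\<Sum>i\<in>{m..M}. \<Sum>n\<in>UNIV. of_bool (i \<le> q n))"
    by (simp add: count)
  also have "\<dots> = (\<Sum>n\<in>UNIV. \<Sum>i\<in>{m..M}. of_bool (i \<le> q n))"
    by (rule sum.swap)
  also have "\<dots> = (\<Sum>n\<in>UNIV. Suc (q n) - m)"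
  proof (rule sum.cong)
    fix n
    have "{m..M} \<inter> {i. i \<le> q n} = {m..q n}" using le[of n] by auto
    then show "(\<Sum>i\<in>{m..M}. of_bool (i \<le> q n)) = Suc (q n) - m" by simp
  qed simp
  finally show ?thesis .
qed

lemma Qbar_plus_Suc: "Qbar_plus q m = Qbar q m + Qbar_plus q (Suc m)"
proof -
  have "Qbar q m = (\<Sum>n\<in>UNIV. of_bool (m \<le> q n))" by (simp add: Qbar_def)
  moreover have "Suc k - m = of_bool (m \<le> k) + (Suc k - Suc m)" for k by auto
  ultimately show ?thesis by (simp only: Qbar_plus_eq sum.distrib)
qed

lemma Qbar_plus_update: "Qbar_plus (q(n := v)) m + (Suc (q n) - m) = Qbar_plus q m + (Suc v - m)"
proof -
  have "(\<Sum>k\<in>UNIV - {n}. Suc ((q(n := v)) k) - m) = (\<Sum>k\<in>UNIV - {n}. Suc (q k) - m)"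
    by (rule sum.cong) auto
  then show ?thesis
    by (simp add: Qbar_plus_eq sum.remove[of UNIV n])
qed

lemma Qbar_plus_increment: "Qbar_plus (q(n := Suc (q n))) m = Qbar_plus q m + of_bool (m \<le> Suc (q n))"
  using Qbar_plus_update[of q n "Suc (q n)" m] by (cases "m \<le> Suc (q n)") auto

text \<open>For \<open>m = 0\<close> and \<open>q n = 0\<close> the update changes nothing although
  the indicator is 1; hence the bound on \<open>m\<close>.\<close>

lemma Qbar_plus_decrement:
  "1 \<le> m \<Longrightarrow> Qbar_plus (q(n := q n - 1)) m + of_bool (m \<le> q n) = Qbar_plus q m"
  using Qbar_plus_update[of q n "q n - 1" m] by (cases "m \<le> q n") auto

text \<open>Weak submajorization of integer vectors: by \<open>Qbar_plus_eq\<close> it compares the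
  sums of the positive parts of x_n - c over all servers, with c = m - 1.\<close>

definition dominated :: "('n::finite \<Rightarrow> nat) \<Rightarrow> ('n \<Rightarrow> nat) \<Rightarrow> bool" where
  "dominated x y \<longleftrightarrow> (\<forall>m\<ge>1. Qbar_plus x m \<le> Qbar_plus y m)"

text \<open>
  The properties of a bijection that maps the \<open>k\<close>-th longest queue of \<open>x\<close> to the \<open>k\<close>-th longest
  queue of \<open>y\<close> for all \<open>k\<close>, phrased without reference to an ordering of the queues.
\<close>

definition rank_matching :: "('n::finite \<Rightarrow> nat) \<Rightarrow> ('n \<Rightarrow> nat) \<Rightarrow> ('n \<Rightarrow> 'n) \<Rightarrow> bool" where
  "rank_matching x y \<tau> \<longleftrightarrow> bij \<tau> \<and>
     (\<forall>n m. x n < m \<and> m \<le> y (\<tau> n) \<longrightarrow> Qbar x m < Qbar y m) \<and>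
     (\<forall>n m. y (\<tau> n) < m \<and> m \<le> x n \<longrightarrow> Qbar y m < Qbar x m)"

lemma ex_decreasing_enumeration:
  fixes x :: "'n::finite \<Rightarrow> nat"
  shows "\<exists>\<sigma>. bij_betw \<sigma> {..<CARD('n)} UNIV \<and> (\<forall>i j. i \<le> j \<longrightarrow> j < CARD('n) \<longrightarrow> x (\<sigma> j) \<le> x (\<sigma> i))"
proof -
  obtain ns :: "'n list" where ns: "set ns = UNIV" "distinct ns"
    using finite_distinct_list[of "UNIV :: 'n set"] by auto
  define ms where "ms = rev (sort_key x ns)"
  have ms: "set ms = UNIV" "distinct ms" using ns by (auto simp: ms_def)
  then have len: "length ms = CARD('n)" using distinct_card by fastforce
  have "sorted (rev (map x ms))" by (simp add: ms_def rev_map)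
  then have "x (ms ! j) \<le> x (ms ! i)" if "i \<le> j" "j < CARD('n)" for i j
    using that len by (auto simp: sorted_rev_iff_nth_mono)
  moreover have "bij_betw (\<lambda>i. ms ! i) {..<CARD('n)} UNIV"
    using bij_betw_nth[OF ms(2)] ms(1) len by simp
  ultimately show ?thesis by blast
qed

text \<open>With ranks counted from 0, a queue of rank \<open>k\<close> below \<open>m\<close> means
  that at most \<open>k\<close> queues reach \<open>m\<close>; one that reaches \<open>m\<close>
  means that more than \<open>k\<close> do. Comparing queues of equal rank gives the strict
  inequalities.\<close>

lemma ex_rank_matching: "\<exists>\<tau>. rank_matching x y \<tau>"
proof -
  let ?N = "CARD('a)"
  obtain \<sigma> where \<sigma>: "bij_betw \<sigma> {..<?N} UNIV" "\<And>i j. i \<le> j \<Longrightarrow> j < ?N \<Longrightarrow> x (\<sigma> j) \<le> x (\<sigma> i)"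
    using ex_decreasing_enumeration[of x] by blast
  obtain \<rho> where \<rho>: "bij_betw \<rho> {..<?N} UNIV" "\<And>i j. i \<le> j \<Longrightarrow> j < ?N \<Longrightarrow> y (\<rho> j) \<le> y (\<rho> i)"
    using ex_decreasing_enumeration[of y] by blast
  define \<tau> where "\<tau> = \<rho> \<circ> inv_into {..<?N} \<sigma>"
  have "bij \<tau>"
    unfolding \<tau>_def by (rule bij_betw_trans[OF bij_betw_inv_into[OF \<sigma>(1)] \<rho>(1)])
  have few: "Qbar z m \<le> k"
    if "bij_betw \<alpha> {..<?N} UNIV" "\<And>i j. i \<le> j \<Longrightarrow> j < ?N \<Longrightarrow> z (\<alpha> j) \<le> z (\<alpha> i)" "z (\<alpha> k) < m"
    for z :: "'a \<Rightarrow> nat" and \<alpha> k m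
  proof -
    have "{n. m \<le> z n} \<subseteq> \<alpha> ` {..<k}"
    proof
      fix n assume n: "n \<in> {n. m \<le> z n}"
      have "n \<in> \<alpha> ` {..<?N}" using that(1) by (simp add: bij_betw_def)
      then obtain i where i: "i < ?N" "n = \<alpha> i" by auto
      have "i < k"
      proof (rule ccontr)
        assume "\<not> i < k"
        then have "z (\<alpha> i) \<le> z (\<alpha> k)" using that(2) i by simp
        with that(3) n i show False by simp
      qed
      with i show "n \<in> \<alpha> ` {..<k}" by blast
    qed
    then have "Qbar z m \<le> card (\<alpha> ` {..<k})" unfolding Qbar_def by (intro card_mono) auto
    also have "\<dots> \<le> k" using card_image_le[of "{..<k}" \<alpha>] by simp
    finally show ?thesis .
  qed
  have many: "k < Qbar z m"
    if "bij_betw \<alpha> {..<?N} UNIV" "\<And>i j. i \<le> j \<Longrightarrow> j < ?N \<Longrightarrow> z (\<alpha> j) \<le> z (\<alpha> i)" "m \<le> z (\<alpha> k)" "k < ?N"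
    for z :: "'a \<Rightarrow> nat" and \<alpha> k m
  proof -
    have "inj_on \<alpha> {..k}" using that(1,4) by (auto simp: bij_betw_def inj_on_def)
    then have "Suc k = card (\<alpha> ` {..k})" by (simp add: card_image)
    also have "\<dots> \<le> Qbar z m"
      unfolding Qbar_def
    proof (rule card_mono)
      show "\<alpha> ` {..k} \<subseteq> {n. m \<le> z n}"
        using that(2)[OF _ that(4)] that(3) by (auto intro: order_trans)
    qed simp
    finally show ?thesis by simp
  qed
  have rank: "\<exists>k<?N. n = \<sigma> k \<and> \<tau> n = \<rho> k" for n
  proof -
    have "n \<in> \<sigma> ` {..<?N}" using \<sigma>(1) by (simp add: bij_betw_def)
    then obtain k where "k < ?N" "n = \<sigma> k" by auto
    then show ?thesis using \<sigma>(1) by (auto simp: \<tau>_def bij_betw_def inv_into_f_f)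
  qed
  have "Qbar x m < Qbar y m" if "x n < m" "m \<le> y (\<tau> n)" for n m
  proof -
    obtain k where "k < ?N" "n = \<sigma> k" "\<tau> n = \<rho> k" using rank by blast
    then show ?thesis using few[where \<alpha>=\<sigma> and z=x and k=k and m=m, OF \<sigma>] many[where \<alpha>=\<rho> and z=y and k=k and m=m, OF \<rho>] that by simp
  qed
  moreover have "Qbar y m < Qbar x m" if "y (\<tau> n) < m" "m \<le> x n" for n m
  proof -
    obtain k where "k < ?N" "n = \<sigma> k" "\<tau> n = \<rho> k" using rank by blast
    then show ?thesis using few[where \<alpha>=\<rho> and z=y and k=k and m=m, OF \<rho>] many[where \<alpha>=\<sigma> and z=x and k=k and m=m, OF \<sigma>] that by simp
  qed
  ultimately show ?thesis using \<open>bij \<tau>\<close> unfolding rank_matching_def by blast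
qed

text \<open>Only a level \<open>m\<close> gained by \<open>x\<close> and not by \<open>y\<close> is
  critical. Then c = m - 1 lies above \<open>y (\<tau> n)\<close> and is at most \<open>x n\<close>,
  so the matching gives more queues of length at least c in \<open>x\<close> than in
  \<open>y\<close>. Domination of the tail sums at c therefore forces strict inequality at
  \<open>m\<close>, leaving room for the new job.\<close>

lemma dominated_arrival:
  assumes d: "dominated x y" and \<tau>: "rank_matching x y \<tau>" and k: "x k \<le> x n"
  shows "dominated (x(k := Suc (x k))) (y(\<tau> n := Suc (y (\<tau> n))))"
  unfolding dominated_def
proof (intro allI impI)
  fix m :: nat assume m: "1 \<le> m"
  have le: "Qbar_plus x m \<le> Qbar_plus y m" using d m by (simp add: dominated_def)
  show "Qbar_plus (x(k := Suc (x k))) m \<le> Qbar_plus (y(\<tau> n := Suc (y (\<tau> n)))) m"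
  proof (cases "m \<le> Suc (x k) \<and> \<not> m \<le> Suc (y (\<tau> n))")
    case True
    then obtain c where c: "m = Suc c" "y (\<tau> n) < c" "c \<le> x n" using k by (cases m) auto
    then have "Qbar y c < Qbar x c" using \<tau> by (auto simp: rank_matching_def)
    moreover have "Qbar_plus x c \<le> Qbar_plus y c" using d c by (auto simp: dominated_def)
    ultimately show ?thesis
      using c by (simp add: Qbar_plus_increment Qbar_plus_Suc[of _ c])
  next
    case False
    then show ?thesis using le by (auto simp: Qbar_plus_increment)
  qed
qed

lemma dominated_arrival_right: "dominated x y \<Longrightarrow> dominated x (y(n := Suc (y n)))"
  by (auto simp: dominated_def Qbar_plus_increment intro: trans_le_add1)

text \<open>Critical are the levels lost by \<open>y\<close> only. There the matching gives strictly
  more queues in \<open>y\<close> at level \<open>m\<close>, and with domination at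
  \<open>Suc m\<close> the tail sums at \<open>m\<close> differ by at least one.\<close>

lemma dominated_departure:
  assumes d: "dominated x y" and \<tau>: "rank_matching x y \<tau>"
  shows "dominated (x(n := x n - 1)) (y(\<tau> n := y (\<tau> n) - 1))"
  unfolding dominated_def
proof (intro allI impI)
  fix m :: nat assume m: "1 \<le> m"
  have le: "Qbar_plus x m \<le> Qbar_plus y m" "Qbar_plus x (Suc m) \<le> Qbar_plus y (Suc m)"
    using d m by (simp_all add: dominated_def)
  have "Qbar_plus x m < Qbar_plus y m" if "x n < m" "m \<le> y (\<tau> n)"
    using \<tau> that le(2) by (auto simp: rank_matching_def Qbar_plus_Suc[of _ m] intro: add_less_le_mono)
  then show "Qbar_plus (x(n := x n - 1)) m \<le> Qbar_plus (y(\<tau> n := y (\<tau> n) - 1)) m"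
    using le(1) Qbar_plus_decrement[OF m, of x n] Qbar_plus_decrement[OF m, of y "\<tau> n"]
    by (cases "m \<le> x n"; cases "m \<le> y (\<tau> n)") auto
qed

text \<open>\<open>LEAST\<close> is meaningful only if the minimum exists; this is compactness of
  the assignments, viewed as points of a Euclidean space.\<close>

lemma lambda0_attained:
  fixes lam :: "'n::finite set \<Rightarrow> real"
  assumes lam: "\<And>S. 0 \<le> lam S"
  shows "\<exists>p. assignment lam p \<and> max_load lam p = lambda0 lam"
proof -
  define load where "load p n = (\<Sum>S | S \<in> selections lam \<and> n \<in> S. lam S * p S n)"
    for p :: "'n set \<Rightarrow> 'n \<Rightarrow> real" and n
  have load_le: "load p n \<le> max_load lam p" for p n
    unfolding load_def max_load_def by (rule Max_ge) auto
  have max_load_le: "max_load lam p \<le> l" if "\<And>n. load p n \<le> l" for p l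
    unfolding max_load_def using that by (subst Max_le_iff) (auto simp: load_def)
  define p\<^sub>0 :: "'n set \<Rightarrow> 'n \<Rightarrow> real" where "p\<^sub>0 S n = 1 / card S" for S n
  have p\<^sub>0: "assignment lam p\<^sub>0"
    by (auto simp: assignment_def p\<^sub>0_def selections_def card_gt_0_iff)
  \<comment> \<open>Coordinates outside the relevant pairs are not constrained by
    \<open>assignment\<close>; setting them to 0 bounds the feasible set and changes no
    load.\<close>
  define vec where "vec p = (\<chi> i. if fst i \<in> selections lam \<and> snd i \<in> fst i then p (fst i) (snd i) else 0)"
    for p :: "'n set \<Rightarrow> 'n \<Rightarrow> real"
  define fam :: "real ^ ('n set \<times> 'n) \<Rightarrow> 'n set \<Rightarrow> 'n \<Rightarrow> real" where "fam v S n = v $ (S, n)" for v S n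
  have load_fam_vec: "load (fam (vec p)) n = load p n" for p n
    by (simp add: load_def fam_def vec_def)
  define box :: "((real ^ ('n set \<times> 'n)) \<times> real) set"
    where "box = cbox (\<chi> i. 0) (\<chi> i. 1) \<times> {0..max_load lam p\<^sub>0}"
  define D where "D = box \<inter> (\<Inter>S\<in>selections lam. {z. (\<Sum>n\<in>S. fam (fst z) S n) = 1}) \<inter>
    (\<Inter>n. {z. load (fam (fst z)) n \<le> snd z})"
  have "compact box" by (auto simp: box_def intro!: compact_Times)
  moreover have "closed (\<Inter>S\<in>selections lam. {z :: (real ^ ('n set \<times> 'n)) \<times> real. (\<Sum>n\<in>S. fam (fst z) S n) = 1})"
    unfolding fam_def by (intro closed_INT ballI closed_Collect_eq continuous_intros)
  moreover have "closed (\<Inter>n. {z :: (real ^ ('n set \<times> 'n)) \<times> real. load (fam (fst z)) n \<le> snd z})"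
    unfolding fam_def load_def by (intro closed_INT ballI closed_Collect_le continuous_intros)
  ultimately have "compact D" unfolding D_def by (intro compact_Int_closed)
  have vec_D: "(vec p, max_load lam p) \<in> D" if p: "assignment lam p" and le: "max_load lam p \<le> max_load lam p\<^sub>0" for p
  proof -
    have p01: "0 \<le> p S n \<and> p S n \<le> 1" if "S \<in> selections lam" "n \<in> S" for S n
    proof -
      have "p S n \<le> (\<Sum>n\<in>S. p S n)"
        using p that by (intro member_le_sum) (auto simp: assignment_def)
      then show ?thesis using p that by (auto simp: assignment_def)
    qed
    have "0 \<le> load p undefined" using p01 lam by (auto simp: load_def intro!: sum_nonneg)
    then have "0 \<le> max_load lam p" using load_le[of p undefined] by linarith
    moreover have "(\<Sum>n\<in>S. fam (vec p) S n) = 1" if "S \<in> selections lam" for S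
      using p that by (simp add: fam_def vec_def assignment_def)
    ultimately show ?thesis
      using le p01 by (auto simp: D_def box_def mem_box_cart vec_def load_fam_vec[unfolded vec_def] load_le)
  qed
  have "D \<noteq> {}" using vec_D[OF p\<^sub>0] by auto
  have "continuous_on D snd" by (intro continuous_intros)
  from continuous_attains_inf[OF \<open>compact D\<close> \<open>D \<noteq> {}\<close> this]
  obtain z where z: "z \<in> D" "\<And>w. w \<in> D \<Longrightarrow> snd z \<le> snd w" by blast
  let ?p = "fam (fst z)"
  have p: "assignment lam ?p"
    using z(1) by (auto simp: assignment_def D_def box_def fam_def mem_box_cart)
  have le: "max_load lam ?p \<le> snd z"
    using z(1) by (intro max_load_le) (auto simp: D_def)
  \<comment> \<open>Assignments with a larger maximal load than \<open>p\<^sub>0\<close> are not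
    represented in \<open>D\<close>, but they exceed the minimum anyway.\<close>
  have minimal: "snd z \<le> max_load lam p'" if p': "assignment lam p'" for p'
  proof (cases "max_load lam p' \<le> max_load lam p\<^sub>0")
    case True
    from z(2)[OF vec_D[OF p' this]] show ?thesis by simp
  next
    case False
    have "snd z \<le> max_load lam p\<^sub>0" using z(1) by (auto simp: D_def box_def)
    with False show ?thesis by simp
  qed
  have "lambda0 lam = max_load lam ?p"
    unfolding lambda0_def
    by (rule Least_equality) (use p le minimal in \<open>auto intro: order_trans\<close>)
  with p show ?thesis by auto
qed

subsection \<open>The coupling\<close>

lemma pmf_embed_pmf_finite:
  fixes w :: "'i::finite \<Rightarrow> real"
  assumes "\<And>i. 0 \<le> w i" and "(\<Sum>i\<in>UNIV. w i) = 1"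
  shows "pmf (embed_pmf w) i = w i"
proof (rule pmf_embed_pmf)
  have "(\<integral>\<^sup>+i. ennreal (w i) \<partial>count_space UNIV) = (\<Sum>i\<in>UNIV. ennreal (w i))"
    by (rule nn_integral_count_space_finite) simp
  also have "\<dots> = ennreal (\<Sum>i\<in>UNIV. w i)" by (rule sum_ennreal) (simp add: assms(1))
  finally show "(\<integral>\<^sup>+i. ennreal (w i) \<partial>count_space UNIV) = 1" by (simp add: assms(2))
qed (rule assms(1))

lemma sum_UNIV_sum:
  fixes f :: "'a::finite + 'b::finite \<Rightarrow> real"
  shows "(\<Sum>e\<in>UNIV. f e) = (\<Sum>a\<in>UNIV. f (Inl a)) + (\<Sum>b\<in>UNIV. f (Inr b))"
  using sum.Plus[of UNIV UNIV f] by simp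

lemma sum_UNIV_triple:
  fixes f :: "'a::finite \<times> 'b::finite \<times> 'c::finite \<Rightarrow> real"
  shows "(\<Sum>e\<in>UNIV. f e) = (\<Sum>a\<in>UNIV. \<Sum>b\<in>UNIV. \<Sum>c\<in>UNIV. f (a, b, c))"
  by (simp only: UNIV_Times_UNIV[symmetric] sum.cartesian_product' [symmetric])
     (simp add: sum.cartesian_product case_prod_beta)

lemma surj_fst: "surj fst" and surj_snd: "surj snd"
  by (metis fst_conv surj_def) (metis snd_conv surj_def)

text \<open>
  The four kinds of events: an arrival with selection \<open>S\<close>, coupled to server \<open>n \<in> S\<close> by the
  assignment and allocated to server \<open>k\<close>; an additional arrival, at the RA system only; a
  completion at rate \<open>mu1\<close>; a completion of a type II job.
\<close>

type_synonym 'n event = "('n set \<times> 'n \<times> 'n) + 'n + 'n + 'n"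

locale coupled_systems =
  fixes lam :: "'n::finite set \<Rightarrow> real" and mu1 mu2 :: real
    and r :: "'n aff_state \<Rightarrow> 'n set \<Rightarrow> 'n pmf"
    and p :: "'n set \<Rightarrow> 'n \<Rightarrow> real" and l :: real
  assumes lam: "\<And>S. 0 \<le> lam S" and mu: "mu1 > mu2" "mu2 > 0"
    and r: "tie_breaking_rule lam r"
    and p: "assignment lam p" and l: "max_load lam p = l"
begin

definition load :: "'n \<Rightarrow> real" where
  "load n = (\<Sum>S | S \<in> selections lam \<and> n \<in> S. lam S * p S n)"

text \<open>A fixed choice for each state, so that the joint evolution is a Markov chain on pairs of
  states.\<close>

definition matching :: "'n aff_state \<times> ('n \<Rightarrow> nat) \<Rightarrow> 'n \<Rightarrow> 'n" where
  "matching z = (SOME \<tau>. rank_matching (\<lambda>n. fst (fst z n)) (snd z) \<tau>)"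

text \<open>Completion events keep their rate at servers with nothing to complete, where they have
  no effect. Together with the extra arrivals this makes the total rate the same in all states, as
  uniformization requires.\<close>

definition rate :: "'n aff_state \<times> ('n \<Rightarrow> nat) \<Rightarrow> 'n event \<Rightarrow> real" where
  "rate z e = (case e of
      Inl (S, n, k) \<Rightarrow> if S \<in> selections lam \<and> n \<in> S then lam S * p S n * pmf (r (fst z) S) k else 0
    | Inr (Inl n) \<Rightarrow> l - load n
    | Inr (Inr (Inl n)) \<Rightarrow> mu1
    | Inr (Inr (Inr n)) \<Rightarrow> mu2)"

definition after :: "'n aff_state \<times> ('n \<Rightarrow> nat) \<Rightarrow> 'n event \<Rightarrow> 'n aff_state \<times> ('n \<Rightarrow> nat)" where
  "after z e = (let x = fst z; y = snd z; \<tau> = matching z in case e of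
      Inl (S, n, k) \<Rightarrow> (allocate S k x, y(\<tau> n := Suc (y (\<tau> n))))
    | Inr (Inl n) \<Rightarrow> (x, y(\<tau> n := Suc (y (\<tau> n))))
    | Inr (Inr (Inl n)) \<Rightarrow> (if fst (x n) > 0 then complete_job n x else x, y(\<tau> n := y (\<tau> n) - 1))
    | Inr (Inr (Inr n)) \<Rightarrow> (if fst (x n) > 0 then x else complete_job n x, y))"

definition total_rate :: real where
  "total_rate = real CARD('n) * (l + mu1 + mu2)"

definition kernel :: "'n aff_state \<times> ('n \<Rightarrow> nat) \<Rightarrow> ('n aff_state \<times> ('n \<Rightarrow> nat)) pmf" where
  "kernel z = map_pmf (after z) (embed_pmf (\<lambda>e. rate z e / total_rate))"

section \<open>Event rates and their sums\<close>

lemma rank_matching: "rank_matching (\<lambda>n. fst (fst z n)) (snd z) (matching z)"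
  unfolding matching_def by (rule someI_ex[OF ex_rank_matching])

lemma sum_matching: "(\<Sum>n\<in>UNIV. f (matching z n)) = (\<Sum>n\<in>UNIV. f n)"
  using rank_matching[of z] unfolding rank_matching_def
  by (intro sum.reindex_bij_betw) simp

lemma sum_assignment: "S \<in> selections lam \<Longrightarrow> (\<Sum>n\<in>S. p S n) = 1"
  and assignment_nonneg: "S \<in> selections lam \<Longrightarrow> n \<in> S \<Longrightarrow> 0 \<le> p S n"
  using p by (auto simp: assignment_def)

lemma load_le: "load n \<le> l"
  unfolding load_def l[symmetric] max_load_def by (rule Max_ge) auto

lemma load_nonneg: "0 \<le> load n"
  unfolding load_def by (rule sum_nonneg) (auto intro!: mult_nonneg_nonneg lam assignment_nonneg)

lemma total_rate_pos: "0 < total_rate"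
proof -
  have "0 \<le> l" using load_nonneg load_le order_trans by blast
  with mu show ?thesis by (simp add: total_rate_def)
qed

lemma rate_nonneg: "0 \<le> rate z e"
  using mu load_le lam assignment_nonneg by (auto simp: rate_def split: sum.split)

text \<open>The allocated server \<open>k\<close> is invisible to the RA system; its probabilities
  sum to 1 and the load of \<open>n\<close> remains.\<close>

lemma sum_arrivals_RA:
  "(\<Sum>S\<in>UNIV. \<Sum>n\<in>UNIV. \<Sum>k\<in>UNIV.
      (if S \<in> selections lam \<and> n \<in> S then lam S * p S n * pmf (r x S) k else 0) * g n) = (\<Sum>n\<in>UNIV. load n * g n)"
proof -
  have "(\<Sum>k\<in>UNIV. (if S \<in> selections lam \<and> n \<in> S then lam S * p S n * pmf (r x S) k else 0) * g n)
      = (if S \<in> selections lam \<and> n \<in> S then lam S * p S n else 0) * g n" for S n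
    using sum_pmf_eq_1[of UNIV "r x S"]
    by (cases "S \<in> selections lam \<and> n \<in> S") (auto simp: sum_distrib_left[symmetric] sum_distrib_right[symmetric])
  then have "(\<Sum>S\<in>UNIV. \<Sum>n\<in>UNIV. \<Sum>k\<in>UNIV.
      (if S \<in> selections lam \<and> n \<in> S then lam S * p S n * pmf (r x S) k else 0) * g n)
    = (\<Sum>n\<in>UNIV. \<Sum>S\<in>UNIV. (if S \<in> selections lam \<and> n \<in> S then lam S * p S n else 0) * g n)"
    by (simp only:) (rule sum.swap)
  also have "\<dots> = (\<Sum>n\<in>UNIV. load n * g n)"
    by (simp add: load_def sum_distrib_right[symmetric] sum.If_cases Collect_conj_eq)
  finally show ?thesis .
qed

text \<open>Conversely, the coupled server \<open>n\<close> is invisible to the affinity system and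
  is summed out by the assignment condition.\<close>

lemma sum_arrivals_aff:
  "(\<Sum>S\<in>UNIV. \<Sum>n\<in>UNIV. \<Sum>k\<in>UNIV.
      (if S \<in> selections lam \<and> n \<in> S then lam S * p S n * pmf (r x S) k else 0) * g S k) =
    (\<Sum>S\<in>selections lam. \<Sum>k\<in>UNIV. lam S * pmf (r x S) k * g S k)"
proof -
  have "(\<Sum>n\<in>UNIV. \<Sum>k\<in>UNIV. (if S \<in> selections lam \<and> n \<in> S then lam S * p S n * pmf (r x S) k else 0) * g S k)
      = (if S \<in> selections lam then \<Sum>k\<in>UNIV. lam S * pmf (r x S) k * g S k else 0)" for S
  proof (cases "S \<in> selections lam")
    case True
    have "(\<Sum>n\<in>UNIV. \<Sum>k\<in>UNIV. (if S \<in> selections lam \<and> n \<in> S then lam S * p S n * pmf (r x S) k else 0) * g S k)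
      = (\<Sum>n\<in>UNIV. if n \<in> S then p S n * (\<Sum>k\<in>UNIV. lam S * pmf (r x S) k * g S k) else 0)"
      using True by (auto simp: sum_distrib_left intro!: sum.cong)
    also have "\<dots> = (\<Sum>n\<in>S. p S n * (\<Sum>k\<in>UNIV. lam S * pmf (r x S) k * g S k))"
      by (simp add: sum.If_cases)
    also have "\<dots> = (\<Sum>k\<in>UNIV. lam S * pmf (r x S) k * g S k)"
      using sum_assignment[OF True] by (simp add: sum_distrib_right[symmetric])
    finally show ?thesis using True by simp
  qed simp
  then show ?thesis by (simp add: sum.If_cases)
qed

lemma sum_rate: "(\<Sum>e\<in>UNIV. rate z e) = total_rate"
proof -
  have "(\<Sum>e\<in>UNIV. rate z e) = (\<Sum>n\<in>UNIV. load n * 1) + ((\<Sum>n\<in>UNIV. l - load n) + (real CARD('n) * mu1 + real CARD('n) * mu2))"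
    unfolding sum_UNIV_sum sum_UNIV_triple sum_arrivals_RA[of "fst z" "\<lambda>_. 1", symmetric]
    by (simp add: rate_def)
  then show ?thesis by (simp add: total_rate_def sum_subtractf algebra_simps)
qed

lemma pmf_event: "pmf (embed_pmf (\<lambda>e. rate z e / total_rate)) e = rate z e / total_rate"
  using total_rate_pos rate_nonneg
  by (intro pmf_embed_pmf_finite) (auto simp: sum_divide_distrib[symmetric] sum_rate)

lemma finite_kernel: "finite (set_pmf (kernel z))"
  by (simp add: kernel_def)

section \<open>The generators of the two projections\<close>

lemma expectation_kernel:
  "measure_pmf.expectation (kernel z) f = f z + (\<Sum>e\<in>UNIV. rate z e * (f (after z e) - f z)) / total_rate"
proof -
  have "measure_pmf.expectation (kernel z) f = (\<Sum>e\<in>UNIV. rate z e / total_rate * f (after z e))"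
    by (simp add: kernel_def integral_measure_pmf_real[of UNIV] pmf_event mult.commute)
  also have "\<dots> = (\<Sum>e\<in>UNIV. rate z e / total_rate * f z) + (\<Sum>e\<in>UNIV. rate z e * (f (after z e) - f z) / total_rate)"
    by (simp add: sum.distrib[symmetric] diff_divide_distrib right_diff_distrib)
  also have "(\<Sum>e\<in>UNIV. rate z e / total_rate * f z) = f z"
    using total_rate_pos by (simp add: sum_distrib_right[symmetric] sum_divide_distrib[symmetric] sum_rate)
  finally show ?thesis by (simp add: sum_divide_distrib)
qed

text \<open>At each server at most one of the two completion events changes the affinity state: the
  \<open>mu1\<close> event if type I jobs are present, otherwise the \<open>mu2\<close> event. The
  matching acts on the RA component only and drops out.\<close>

lemma rate_aff:
  "(\<Sum>e\<in>UNIV. rate z e * (f (fst (after z e)) - f (fst z))) = aff_generator lam mu1 mu2 r f (fst z)"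
proof -
  let ?x = "fst z"
  have idle: "complete_job n ?x = ?x" if "fst (?x n) = 0" "snd (?x n) = 0" for n
    using that by (simp add: complete_job_def fun_eq_iff prod_eq_iff)
  have completion: "mu1 * (f (if 0 < fst (?x n) then complete_job n ?x else ?x) - f ?x) +
      mu2 * (f (if 0 < fst (?x n) then ?x else complete_job n ?x) - f ?x)
    = completion_rate mu1 mu2 ?x n * (f (complete_job n ?x) - f ?x)" for n
    using idle[of n] by (auto simp: completion_rate_def)
  have "(\<Sum>e\<in>UNIV. rate z e * (f (fst (after z e)) - f ?x)) =
    (\<Sum>S\<in>UNIV. \<Sum>n\<in>UNIV. \<Sum>k\<in>UNIV.
      (if S \<in> selections lam \<and> n \<in> S then lam S * p S n * pmf (r ?x S) k else 0) * (f (allocate S k ?x) - f ?x))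
    + (\<Sum>n\<in>UNIV. mu1 * (f (if 0 < fst (?x n) then complete_job n ?x else ?x) - f ?x) +
      mu2 * (f (if 0 < fst (?x n) then ?x else complete_job n ?x) - f ?x))"
    unfolding sum_UNIV_sum sum_UNIV_triple
    by (simp add: rate_def after_def Let_def sum.distrib)
  also have "\<dots> = aff_generator lam mu1 mu2 r f ?x"
    unfolding completion aff_generator_def
    by (simp only: sum_arrivals_aff[of ?x "\<lambda>S k. f (allocate S k ?x) - f ?x"])
  finally show ?thesis .
qed

text \<open>Coupled and extra arrivals at \<open>n\<close> add up to the rate \<open>l\<close>,
  which is the same for all servers, so the sum can be reindexed along the matching. Completions at
  empty queues change nothing, which accounts for the condition in
  \<open>ra_generator\<close>.\<close>

lemma rate_RA:
  "(\<Sum>e\<in>UNIV. rate z e * (f (snd (after z e)) - f (snd z))) = ra_generator (l * real CARD('n)) mu1 f (snd z)"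
proof -
  let ?y = "snd z" and ?\<tau> = "matching z"
  let ?up = "\<lambda>n. f (?y(n := Suc (?y n))) - f ?y" and ?down = "\<lambda>n. f (?y(n := ?y n - 1)) - f ?y"
  have "(\<Sum>e\<in>UNIV. rate z e * (f (snd (after z e)) - f ?y)) =
    (\<Sum>S\<in>UNIV. \<Sum>n\<in>UNIV. \<Sum>k\<in>UNIV.
      (if S \<in> selections lam \<and> n \<in> S then lam S * p S n * pmf (r (fst z) S) k else 0) * ?up (?\<tau> n))
    + ((\<Sum>n\<in>UNIV. (l - load n) * ?up (?\<tau> n)) + (\<Sum>n\<in>UNIV. mu1 * ?down (?\<tau> n)))"
    unfolding sum_UNIV_sum sum_UNIV_triple
    by (simp add: rate_def after_def Let_def)
  also have "\<dots> = (\<Sum>n\<in>UNIV. load n * ?up (?\<tau> n) + (l - load n) * ?up (?\<tau> n)) + (\<Sum>n\<in>UNIV. mu1 * ?down (?\<tau> n))"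
    by (simp only: sum_arrivals_RA[of "fst z" "\<lambda>n. ?up (?\<tau> n)"] sum.distrib add.assoc)
  also have "\<dots> = (\<Sum>n\<in>UNIV. l * ?up (?\<tau> n)) + (\<Sum>n\<in>UNIV. mu1 * ?down (?\<tau> n))"
    by (simp only: distrib_right[symmetric]) simp
  also have "\<dots> = (\<Sum>n\<in>UNIV. l * ?up n) + (\<Sum>n\<in>UNIV. mu1 * ?down n)"
    by (simp only: sum_matching[of "\<lambda>n. l * ?up n"] sum_matching[of "\<lambda>n. mu1 * ?down n"])
  also have "(\<Sum>n\<in>UNIV. mu1 * ?down n) = (\<Sum>n\<in>UNIV. (if ?y n > 0 then mu1 else 0) * ?down n)"
  proof (rule sum.cong)
    fix n
    have "?y(n := ?y n - 1) = ?y" if "?y n = 0" using that by (simp add: fun_eq_iff)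
    then show "mu1 * ?down n = (if ?y n > 0 then mu1 else 0) * ?down n" by simp
  qed simp
  finally have total: "(\<Sum>e\<in>UNIV. rate z e * (f (snd (after z e)) - f ?y))
    = (\<Sum>n\<in>UNIV. l * ?up n) + (\<Sum>n\<in>UNIV. (if ?y n > 0 then mu1 else 0) * ?down n)" .
  have "l * real CARD('n) * pmf (pmf_of_set (UNIV :: 'n set)) n = l" for n by simp
  then show ?thesis by (simp only: total ra_generator_def)
qed

sublocale aff: lumped_jump_chain kernel total_rate fst "aff_generator lam mu1 mu2 r"
  by unfold_locales (simp_all add: total_rate_pos finite_kernel surj_fst expectation_kernel rate_aff)

text \<open>Same \<open>kernel\<close> and \<open>total_rate\<close> as for \<open>aff\<close>,
  hence the same driver and process: both projections live on one probability space.\<close>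

sublocale RA: lumped_jump_chain kernel total_rate snd "ra_generator (l * real CARD('n)) mu1"
  by unfold_locales (simp_all add: total_rate_pos finite_kernel surj_snd expectation_kernel rate_RA)

text \<open>A job allocated within \<open>S\<close> goes either to an idle server, which has no type
  I jobs, or to a minimizer whose first criterion is the number of type I jobs.\<close>

lemma fst_candidate:
  assumes "k \<in> candidates x S" "k \<in> S" "n \<in> S"
  shows "fst (x k) \<le> fst (x n)"
  using assms by (auto simp: candidates_def idle_def split: if_splits)

text \<open>A nonzero rate guarantees that the tie-breaking rule can choose \<open>k\<close>.
  Allocation outside \<open>S\<close> creates a type II job: the type I counts stay while RA gains a
  job, which is harmless, just like an extra arrival.\<close>

lemma dominated_after:
  fixes z :: "'n aff_state \<times> ('n \<Rightarrow> nat)"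
  assumes z: "dominated (\<lambda>n. fst (fst z n)) (snd z)" and e: "rate z e \<noteq> 0"
  shows "dominated (\<lambda>n. fst (fst (after z e) n)) (snd (after z e))"
proof -
  let ?x = "\<lambda>n. fst (fst z n)"
  consider (arrival) S n k where "e = Inl (S, n, k)" | (extra) n where "e = Inr (Inl n)"
    | (service1) n where "e = Inr (Inr (Inl n))" | (service2) n where "e = Inr (Inr (Inr n))"
    by (metis obj_sumE prod_cases3)
  then show ?thesis
  proof cases
    case arrival
    with e have S: "S \<in> selections lam" "n \<in> S" "k \<in> set_pmf (r (fst z) S)"
      by (auto simp: rate_def set_pmf_iff split: if_splits)
    then have k: "k \<in> candidates (fst z) S" using r by (auto simp: tie_breaking_rule_def)
    show ?thesis
    proof (cases "k \<in> S")
      case True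
      have "(\<lambda>j. fst (allocate S k (fst z) j)) = ?x(k := Suc (?x k))"
        using True by (auto simp: allocate_def)
      then show ?thesis
        using dominated_arrival[OF z rank_matching fst_candidate[OF k True S(2)]] arrival
        by (simp add: after_def Let_def)
    next
      case False
      have "(\<lambda>j. fst (allocate S k (fst z) j)) = ?x"
        using False by (auto simp: allocate_def)
      then show ?thesis using dominated_arrival_right[OF z] arrival by (simp add: after_def Let_def)
    qed
  next
    case extra
    then show ?thesis using dominated_arrival_right[OF z] by (simp add: after_def Let_def)
  next
    case service1
    have "(\<lambda>j. fst ((if fst (fst z n) > 0 then complete_job n (fst z) else fst z) j)) = ?x(n := ?x n - 1)"
      by (auto simp: complete_job_def)
    then show ?thesis using dominated_departure[OF z rank_matching, of n] service1
      by (simp add: after_def Let_def)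
  next
    case service2
    have "(\<lambda>j. fst ((if fst (fst z n) > 0 then fst z else complete_job n (fst z)) j)) = ?x"
      by (auto simp: complete_job_def)
    then show ?thesis using z service2 by (simp add: after_def Let_def)
  qed
qed

lemma AE_dominated:
  assumes "dominated (\<lambda>n. fst (x n)) y"
  shows "AE \<omega> in aff.driver. \<forall>t. dominated (\<lambda>n. fst (fst (aff.process (x, y) t \<omega>) n)) (snd (aff.process (x, y) t \<omega>))"
proof -
  have "AE \<omega> in aff.driver. \<forall>t. aff.process (x, y) t \<omega> \<in> {z. dominated (\<lambda>n. fst (fst z n)) (snd z)}"
  proof (rule aff.AE_process_invariant)
    fix z :: "'n aff_state \<times> ('n \<Rightarrow> nat)" assume z: "z \<in> {z. dominated (\<lambda>n. fst (fst z n)) (snd z)}"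
    have "rate z e \<noteq> 0" if "e \<in> set_pmf (embed_pmf (\<lambda>e. rate z e / total_rate))" for e
      using that by (simp add: set_pmf_iff pmf_event)
    then show "set_pmf (kernel z) \<subseteq> {z. dominated (\<lambda>n. fst (fst z n)) (snd z)}"
      using dominated_after[of z] z by (auto simp: kernel_def)
  qed (use assms in simp)
  then show ?thesis by simp
qed

end

lemma copy_of_markov_jump_process:
  fixes F :: "nat \<Rightarrow> 's::countable \<Rightarrow> nat"
  assumes X': "markov_jump_process A x0 M' X'" and X: "markov_jump_process A x0 M X"
  shows "copy_of_process M' (\<lambda>m t \<omega>. F m (X' t \<omega>)) M (\<lambda>m t \<omega>. F m (X t \<omega>))"
  unfolding copy_of_process_def
proof (intro conjI allI impI)
  fix m :: nat and t :: real assume "0 \<le> t"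
  then have "X' t \<in> measurable M' (count_space UNIV)" using X' by (simp add: markov_jump_process_def)
  then show "(\<lambda>\<omega>. F m (X' t \<omega>)) \<in> measurable M' (count_space UNIV)"
    by (rule measurable_compose) simp
next
  fix m
  have "AE \<omega> in M'. \<forall>t\<ge>0. eventually (\<lambda>s. X' s \<omega> = X' t \<omega>) (at_right t)"
    using X' by (simp add: markov_jump_process_def right_continuous_paths_def)
  then show "right_continuous_paths M' (\<lambda>t \<omega>. F m (X' t \<omega>))"
    unfolding right_continuous_paths_def
  proof (rule eventually_mono, intro allI impI)
    fix \<omega> and t :: real
    assume "\<forall>t\<ge>0. eventually (\<lambda>s. X' s \<omega> = X' t \<omega>) (at_right t)" "0 \<le> t"
    then have "eventually (\<lambda>s. X' s \<omega> = X' t \<omega>) (at_right t)" by blast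
    then show "eventually (\<lambda>s. F m (X' s \<omega>) = F m (X' t \<omega>)) (at_right t)"
      by (rule eventually_mono) simp
  qed
next
  show "process_law M' (\<lambda>m t \<omega>. F m (X' t \<omega>)) = process_law M (\<lambda>m t \<omega>. F m (X t \<omega>))"
    using X' X
    by (intro process_law_cong_distributions finite_dimensional_distributions_unique[OF X' X])
      (auto simp: markov_jump_process_def)
qed

theorem theorem3p1:
  fixes lam :: "'n::finite set \<Rightarrow> real" and mu1 mu2 :: real
    and r :: "'n aff_state \<Rightarrow> 'n set \<Rightarrow> 'n pmf"
    and x0 :: "'n aff_state" and y0 :: "'n \<Rightarrow> nat"
    and M1 :: "'w1 measure" and X :: "real \<Rightarrow> 'w1 \<Rightarrow> 'n aff_state"
    and M2 :: "'w2 measure" and Y :: "real \<Rightarrow> 'w2 \<Rightarrow> 'n \<Rightarrow> nat"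
  assumes "\<And>S. lam S \<ge> 0" and "mu1 > mu2" and "mu2 > 0"
    and "tie_breaking_rule lam r"
    and "affinity_system lam mu1 mu2 r x0 M1 X"
    and "ra_system (lambda0 lam * real CARD('n)) mu1 y0 M2 Y"
    and "\<And>m. m \<ge> 1 \<Longrightarrow> Qbar_plus (\<lambda>n. fst (x0 n)) m \<le> Qbar_plus y0 m"
  shows "process_st_le
           M1 (\<lambda>m t \<omega>. Qbar_plus (\<lambda>n. fst (X t \<omega> n)) m)
           M2 (\<lambda>m t \<omega>. Qbar_plus (Y t \<omega>) m)"
proof -
  obtain p where p: "assignment lam p" "max_load lam p = lambda0 lam"
    using lambda0_attained[of lam] assms(1) by blast
  interpret coupled_systems lam mu1 mu2 r p "lambda0 lam"
    by unfold_locales (use assms p in auto)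
  let ?Z = "aff.process (x0, y0)"
  have X: "markov_jump_process (aff_generator lam mu1 mu2 r) x0 M1 X"
    using assms(5) by (simp add: affinity_system_def)
  have Y: "markov_jump_process (ra_generator (lambda0 lam * real CARD('n)) mu1) y0 M2 Y"
    using assms(6) by (simp add: ra_system_def)
  have X': "markov_jump_process (aff_generator lam mu1 mu2 r) x0 aff.driver (\<lambda>t \<omega>. fst (?Z t \<omega>))"
    using aff.markov_jump_process_process[of "(x0, y0)"] by simp
  have Y': "markov_jump_process (ra_generator (lambda0 lam * real CARD('n)) mu1) y0 aff.driver (\<lambda>t \<omega>. snd (?Z t \<omega>))"
    using RA.markov_jump_process_process[of "(x0, y0)"] by simp
  show ?thesis
  proof (rule process_st_leI[OF aff.prob_space_driver])
    show "copy_of_process aff.driver (\<lambda>m t \<omega>. Qbar_plus (\<lambda>n. fst (fst (?Z t \<omega>) n)) m)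
        M1 (\<lambda>m t \<omega>. Qbar_plus (\<lambda>n. fst (X t \<omega> n)) m)"
      by (rule copy_of_markov_jump_process[OF X' X, of "\<lambda>m x. Qbar_plus (\<lambda>n. fst (x n)) m"])
    show "copy_of_process aff.driver (\<lambda>m t \<omega>. Qbar_plus (snd (?Z t \<omega>)) m)
        M2 (\<lambda>m t \<omega>. Qbar_plus (Y t \<omega>) m)"
      by (rule copy_of_markov_jump_process[OF Y' Y, of "\<lambda>m y. Qbar_plus y m"])
    have "dominated (\<lambda>n. fst (x0 n)) y0" using assms(7) by (simp add: dominated_def)
    from AE_dominated[OF this]
    show "AE \<omega> in aff.driver. \<forall>m\<ge>1. \<forall>t\<ge>0.
        Qbar_plus (\<lambda>n. fst (fst (?Z t \<omega>) n)) m \<le> Qbar_plus (snd (?Z t \<omega>)) m"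
      by eventually_elim (simp add: dominated_def)
  qed
qed

end
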